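(* Let $0<q<1$, and let $\mathfrak G_\sigma$ be the set of real $\sigma$-metrics $g_I:\Omega^{\otimes2}(\mathrm{SU}_q(2))\to\mathcal A(\mathrm{SU}_q(2))$ for the $4D_+$ calculus which satisfy $g_I(\omega_a,\omega_b)\in\mathbb C$ on left-invariant 1-forms and which are right $\mathrm U(1)$-coinvariant. Let $\mathfrak G$ be the set of bilinear forms $\tilde g_q$ on the space of left-invariant 1-forms whose matrix in the ordered basis $(\omega_-,\omega_+,\omega_0,\omega_z)$ is $$\tilde g_{q\,ab}=\begin{pmatrix}0&q^2\mathsf a&0&0\\ \mathsf a&0&0&0\\0&0&0&\pm(1-q^2)\mathsf a\\0&0&\pm(1-q^2)\mathsf a&\pm(1+q^2)\mathsf a\end{pmatrix},\qquad \mathsf a\in\mathbb R\setminus\{0\},$$ with the same choice of sign in all three entries. Then $\mathfrak G_\sigma\subset\mathfrak G$ (restricting $g_I$ to left-invariant 1-forms); more precisely, every $g_I\in\mathfrak G_\sigma$ coincides with an element $\tilde g_q\in\mathfrak G$ with the upper sign $+$, i.e. with $\tilde g_q(\omega_a,\omega_b)=\Gamma(\omega_a^*,\omega_b)$ for the sesquilinear contraction $\Gamma$ whose only nonzero coefficients are $\Gamma(\omega_-,\omega_-)=\alpha$, $\Gamma(\omega_+,\omega_+)=q^2\alpha$, $\Gamma(\omega_0,\omega_z)=\Gamma(\omega_z,\omega_0)=(1-q^2)\alpha$, $\Gamma(\omega_z,\omega_z)=(1+q^2)\alpha$, where $\alpha=-\mathsf a$.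
   Context: **Algebras.** $\mathcal A=\mathcal A(\mathrm{SU}_q(2))$ is the unital $*$-algebra generated by $a,c$ with $ac=qca$, $ac^*=qc^*a$, $cc^*=c^*c$, $a^*a+c^*c=aa^*+q^2cc^*=1$, a Hopf $*$-algebra with $\Delta U=U\otimes U$ for $U=\begin{pmatrix}a&-qc^*\\c&a^*\end{pmatrix}$. $\mathcal U_q(\mathfrak{su}(2))$ is generated by $K^{\pm1},E,F$ with $K^{\pm1}E=q^{\pm1}EK^{\pm1}$, $K^{\pm1}F=q^{\mp1}FK^{\pm1}$, $[E,F]=(K^2-K^{-2})/(q-q^{-1})$, $\Delta K^{\pm1}=K^{\pm1}\otimes K^{\pm1}$, $\Delta E=E\otimes K+K^{-1}\otimes E$, $\Delta F=F\otimes K+K^{-1}\otimes F$. They are (nondegenerately) dually paired by $\langle K^{\pm1},a\rangle=q^{\mp1/2}$, $\langle K^{\pm1},a^*\rangle=q^{\pm1/2}$, $\langle E,c\rangle=1$, $\langle F,c^*\rangle=-q^{-1}$ (other pairs of generators pair to $0$), and $h\triangleright x=x_{(1)}\langle h,x_{(2)}\rangle$. **$4D_+$ calculus.** $L_-=q^{1/2}FK^{-1}$, $L_+=q^{-1/2}EK^{-1}$, $L_z=\frac{K^{-2}-1}{q-q^{-1}}$, $L_0=\frac{q(K^2-1)+q^{-1}(K^{-2}-1)}{(q-q^{-1})^2}+FE$. $\Omega^1(\mathrm{SU}_q(2))$ is the free left $\mathcal A$-module on left-invariant 1-forms $\omega_-,\omega_+,\omega_0,\omega_z$, with $\mathrm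 dx=\sum_a(L_a\triangleright x)\omega_a$ and right multiplication $\omega_ax=\sum_b(f_{ab}\triangleright x)\omega_b$, where $\Delta(L_a)=1\otimes L_a+\sum_bL_b\otimes f_{ba}$. The involution satisfies $\omega_-^*=-\omega_+$, $\omega_+^*=-\omega_-$, $\omega_0^*=-\omega_0$, $\omega_z^*=-\omega_z$, $(x\,\phi\,y)^*=y^*\phi^*x^*$. $\Omega^{\otimes k}(\mathrm{SU}_q(2))$ is the $k$-fold tensor product over $\mathcal A$. **Braiding.** $\sigma:\Omega^{\otimes2}(\mathrm{SU}_q(2))\to\Omega^{\otimes2}(\mathrm{SU}_q(2))$ is the invertible $\mathcal A$-bimodule map which, writing $ab$ for $\omega_a\otimes\omega_b$, is: $\sigma(--)=--$, $\sigma(++)=++$, $\sigma(00)=00$; $\sigma(-0)=(1-q^2)(-0)+(0-)$, $\sigma(0-)=q^2(-0)$, $\sigma(-z)=(1+q^2)(-0)+(z-)$, $\sigma(z-)=-(1+q^{-2})(-0)+q^{-2}(-z)+(1-q^{-2})(z-)$; $\sigma(+0)=(1-q^{-2})(+0)+(0+)$, $\sigma(0+)=q^{-2}(+0)$, $\sigma(+z)=-(1+q^{-2})(+0)+(z+)$, $\sigma(z+)=(1+q^2)(+0)+q^2(+z)+(1-q^2)(z+)$; $\sigma(z0)=(0z)-(q-q^{-1})^2[(z0)+(-+)-(+-)]$, $\sigma(0z)=(z0)$, $\sigma(zz)=(zz)+(q^2-q^{-2})[(z0)+(-+)-(+-)]$, $\sigma(-+)=-(z0)+(+-)$, $\sigma(+-)=(z0)+(-+)$.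 On $\Omega^{\otimes3}$, $\sigma_1=\sigma\otimes1$ and $\sigma_2=1\otimes\sigma$. **$\sigma$-metrics.** A (non-degenerate) $\sigma$-metric is a map $g_I:\Omega^{\otimes2}(\mathrm{SU}_q(2))\to\mathcal A$ such that: (i) $g_I$ is a homomorphism of $\mathcal A$-bimodules; (ii) $g_I$ is non-degenerate; (iii) $g_I\circ\sigma^{\pm1}=g_I$; (iv) $(g_I\otimes1)\circ\sigma_2^{\pm1}=(1\otimes g_I)\circ\sigma_1^{\mp1}$ on $\Omega^{\otimes3}(\mathrm{SU}_q(2))$. It is *real* if $(g_I(\phi,\phi'))^*=g_I(\phi'^*,\phi^* )$ for all 1-forms $\phi,\phi'$, where $g_I(\phi,\phi')=g_I(\phi\otimes\phi')$. It is *right $\mathrm U(1)$-coinvariant* if $g_I(\omega_a,\omega_b)=0$ whenever $n_a+n_b\ne0$, where $n_a$ is the $\mathrm U(1)$-weight of $\omega_a$: $n_0=n_z=0$ and $n_-=-n_+\neq0$. *)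

theory Defs
  imports Complex_Main "HOL-Library.Poly_Mapping" "HOL-Library.Product_Plus"
    "HOL-Algebra.QuotRing"
begin

section \<open>Free algebras and quotients by relations\<close>

text \<open>With concatenation as addition, finitely supported functions
  \<open>'g list \<Rightarrow>\<^sub>0 complex\<close> form the free unital complex algebra on the generators \<open>'g\<close>, and
  finitely supported functions on pairs of words form the tensor product over the complex
  numbers of two free algebras.\<close>

instantiation list :: (type) monoid_add
begin
definition zero_list :: "'a list" where "zero_list = []"
definition plus_list :: "'a list \<Rightarrow> 'a list \<Rightarrow> 'a list" where "plus_list = (@)"
instance by standard (simp_all add: zero_list_def plus_list_def)
end

type_synonym 'g falg = "'g list \<Rightarrow>\<^sub>0 complex"
type_synonym ('g, 'h) falg2 = "('g list \<times> 'h list) \<Rightarrow>\<^sub>0 complex"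

definition fconst :: "complex \<Rightarrow> ('m::monoid_add \<Rightarrow>\<^sub>0 complex)" where
  "fconst z = Poly_Mapping.single 0 z"

definition fgen :: "'g \<Rightarrow> 'g falg" where
  "fgen g = Poly_Mapping.single [g] 1"

definition ftensor :: "'g falg \<Rightarrow> 'h falg \<Rightarrow> ('g, 'h) falg2"  (infixr "\<otimes>\<^sub>f" 71) where
  "x \<otimes>\<^sub>f y = (\<Sum>u\<in>Poly_Mapping.keys x. \<Sum>v\<in>Poly_Mapping.keys y.
     Poly_Mapping.single (u, v) (Poly_Mapping.lookup x u * Poly_Mapping.lookup y v))"

text \<open>The algebra homomorphism extending an assignment on generators.\<close>

definition fhom :: "('g \<Rightarrow> ('m::monoid_add \<Rightarrow>\<^sub>0 complex)) \<Rightarrow> 'g falg \<Rightarrow> ('m \<Rightarrow>\<^sub>0 complex)" where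
  "fhom \<phi> x = (\<Sum>w\<in>Poly_Mapping.keys x.
     fconst (Poly_Mapping.lookup x w) * prod_list (map \<phi> w))"

definition ring_of :: "'a::ring_1 ring" where
  "ring_of = \<lparr>carrier = UNIV, mult = (*), one = 1, zero = 0, add = (+)\<rparr>"


section \<open>The algebra of quantum SU(2)\<close>

datatype agen = Ga | Gc | Gas | Gcs   \<comment> \<open>\<open>a\<close>, \<open>c\<close>, \<open>a\<^sup>*\<close>, \<open>c\<^sup>*\<close>\<close>

abbreviation gen_a :: "agen falg" where "gen_a \<equiv> fgen Ga"
abbreviation gen_c :: "agen falg" where "gen_c \<equiv> fgen Gc"
abbreviation gen_as :: "agen falg" where "gen_as \<equiv> fgen Gas"
abbreviation gen_cs :: "agen falg" where "gen_cs \<equiv> fgen Gcs"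

fun agen_star :: "agen \<Rightarrow> agen" where
  "agen_star Ga = Gas" | "agen_star Gas = Ga" | "agen_star Gc = Gcs" | "agen_star Gcs = Gc"

definition fstar :: "agen falg \<Rightarrow> agen falg" where
  "fstar x = (\<Sum>w\<in>Poly_Mapping.keys x.
     Poly_Mapping.single (rev (map agen_star w)) (cnj (Poly_Mapping.lookup x w)))"

definition SU_rels :: "real \<Rightarrow> agen falg set" where
  "SU_rels q =
    {gen_a * gen_c - fconst q * gen_c * gen_a,
     gen_a * gen_cs - fconst q * gen_cs * gen_a,
     gen_c * gen_cs - gen_cs * gen_c,
     gen_as * gen_a + gen_cs * gen_c - 1,
     gen_a * gen_as + fconst (q^2) * gen_c * gen_cs - 1}"

text \<open>Relations of a \<open>*\<close>-algebra: together with a relation, its adjoint is imposed.\<close>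

definition SU_ideal :: "real \<Rightarrow> agen falg set" where
  "SU_ideal q = genideal ring_of (SU_rels q \<union> fstar ` SU_rels q)"

type_synonym su = "agen falg set"

definition SU :: "real \<Rightarrow> su ring" where
  "SU q = ring_of Quot SU_ideal q"

definition cls :: "real \<Rightarrow> agen falg \<Rightarrow> su" where
  "cls q x = SU_ideal q +>\<^bsub>ring_of\<^esub> x"

definition scal :: "real \<Rightarrow> complex \<Rightarrow> su" where
  "scal q z = cls q (fconst z)"

text \<open>The involution of the quotient: the ideal is stable under \<^const>\<open>fstar\<close>, so that the image
  of a coset is again a coset.\<close>

definition su_star :: "su \<Rightarrow> su" where
  "su_star X = fstar ` X"

text \<open>\<open>\<Delta>U = U \<otimes> U\<close> for the matrix \<open>U\<close> with rows \<open>(a, -q c\<^sup>*)\<close> and \<open>(c, a\<^sup>*)\<close>.\<close>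

fun SU_coprod_gen :: "real \<Rightarrow> agen \<Rightarrow> (agen, agen) falg2" where
  "SU_coprod_gen q Ga = gen_a \<otimes>\<^sub>f gen_a - fconst q * (gen_cs \<otimes>\<^sub>f gen_c)"
| "SU_coprod_gen q Gc = gen_c \<otimes>\<^sub>f gen_a + gen_as \<otimes>\<^sub>f gen_c"
| "SU_coprod_gen q Gas = gen_as \<otimes>\<^sub>f gen_as - fconst q * (gen_c \<otimes>\<^sub>f gen_cs)"
| "SU_coprod_gen q Gcs = gen_a \<otimes>\<^sub>f gen_cs + gen_cs \<otimes>\<^sub>f gen_as"

definition SU_coprod :: "real \<Rightarrow> agen falg \<Rightarrow> (agen, agen) falg2" where
  "SU_coprod q = fhom (SU_coprod_gen q)"

fun SU_counit_gen :: "agen \<Rightarrow> complex" where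
  "SU_counit_gen Ga = 1" | "SU_counit_gen Gas = 1" | "SU_counit_gen Gc = 0" | "SU_counit_gen Gcs = 0"

definition SU_counit :: "agen list \<Rightarrow> complex" where
  "SU_counit w = prod_list (map SU_counit_gen w)"


section \<open>The quantized enveloping algebra, the dual pairing and the left action\<close>

datatype ugen = GK | GKi | GE | GF

abbreviation KK :: "ugen falg" where "KK \<equiv> fgen GK"
abbreviation Ki :: "ugen falg" where "Ki \<equiv> fgen GKi"
abbreviation EE :: "ugen falg" where "EE \<equiv> fgen GE"
abbreviation FF :: "ugen falg" where "FF \<equiv> fgen GF"

definition U_rels :: "real \<Rightarrow> ugen falg set" where
  "U_rels q =
    {KK * Ki - 1, Ki * KK - 1,
     KK * EE - fconst q * EE * KK, Ki * EE - fconst (1 / q) * EE * Ki,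
     KK * FF - fconst (1 / q) * FF * KK, Ki * FF - fconst q * FF * Ki,
     EE * FF - FF * EE - fconst (1 / (q - 1 / q)) * (KK^2 - Ki^2)}"

definition U2_ideal :: "real \<Rightarrow> (ugen, ugen) falg2 set" where
  "U2_ideal q = genideal ring_of ((\<lambda>r. r \<otimes>\<^sub>f 1) ` U_rels q \<union> (\<lambda>r. 1 \<otimes>\<^sub>f r) ` U_rels q)"

fun U_coprod_gen :: "ugen \<Rightarrow> (ugen, ugen) falg2" where
  "U_coprod_gen GK = KK \<otimes>\<^sub>f KK"
| "U_coprod_gen GKi = Ki \<otimes>\<^sub>f Ki"
| "U_coprod_gen GE = EE \<otimes>\<^sub>f KK + Ki \<otimes>\<^sub>f EE"
| "U_coprod_gen GF = FF \<otimes>\<^sub>f KK + Ki \<otimes>\<^sub>f FF"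

definition U_coprod :: "ugen falg \<Rightarrow> (ugen, ugen) falg2" where
  "U_coprod = fhom U_coprod_gen"

fun U_counit_gen :: "ugen \<Rightarrow> complex" where
  "U_counit_gen GK = 1" | "U_counit_gen GKi = 1" | "U_counit_gen GE = 0" | "U_counit_gen GF = 0"

fun pair0 :: "real \<Rightarrow> ugen \<Rightarrow> agen \<Rightarrow> complex" where
  "pair0 q GK Ga = 1 / sqrt q"
| "pair0 q GK Gas = sqrt q"
| "pair0 q GKi Ga = sqrt q"
| "pair0 q GKi Gas = 1 / sqrt q"
| "pair0 q GE Gc = 1"
| "pair0 q GF Gcs = - 1 / q"
| "pair0 q _ _ = 0"

text \<open>The Hopf pairing is extended from generators by
  \<open>\<langle>h, 1\<rangle> = \<epsilon>(h)\<close>, \<open>\<langle>h, x y\<rangle> = \<langle>h\<^sub>(\<^sub>1\<^sub>), x\<rangle> \<langle>h\<^sub>(\<^sub>2\<^sub>), y\<rangle>\<close>,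
  \<open>\<langle>1, x\<rangle> = \<epsilon>(x)\<close> and \<open>\<langle>h k, x\<rangle> = \<langle>h, x\<^sub>(\<^sub>1\<^sub>)\<rangle> \<langle>k, x\<^sub>(\<^sub>2\<^sub>)\<rangle>\<close>.\<close>

fun pair_gen :: "real \<Rightarrow> ugen \<Rightarrow> agen list \<Rightarrow> complex" where
  "pair_gen q g [] = U_counit_gen g"
| "pair_gen q GK (x # w) = pair0 q GK x * pair_gen q GK w"
| "pair_gen q GKi (x # w) = pair0 q GKi x * pair_gen q GKi w"
| "pair_gen q GE (x # w) = pair0 q GE x * pair_gen q GK w + pair0 q GKi x * pair_gen q GE w"
| "pair_gen q GF (x # w) = pair0 q GF x * pair_gen q GK w + pair0 q GKi x * pair_gen q GF w"

primrec pair_word :: "real \<Rightarrow> ugen list \<Rightarrow> agen list \<Rightarrow> complex" where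
  "pair_word q [] x = SU_counit x"
| "pair_word q (g # h) x =
    (let D = SU_coprod q (Poly_Mapping.single x 1) in
     \<Sum>(u, v)\<in>Poly_Mapping.keys D.
       Poly_Mapping.lookup D (u, v) * pair_gen q g u * pair_word q h v)"

definition pairing :: "real \<Rightarrow> ugen falg \<Rightarrow> agen falg \<Rightarrow> complex" where
  "pairing q h x = (\<Sum>k\<in>Poly_Mapping.keys h. \<Sum>w\<in>Poly_Mapping.keys x.
     Poly_Mapping.lookup h k * Poly_Mapping.lookup x w * pair_word q k w)"

text \<open>\<open>h \<triangleright> x = x\<^sub>(\<^sub>1\<^sub>) \<langle>h, x\<^sub>(\<^sub>2\<^sub>)\<rangle>\<close>, on representatives and on the quotient. Elements of the
  enveloping algebra enter only through this action, which does not depend on the representative.\<close>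

definition free_act :: "real \<Rightarrow> ugen falg \<Rightarrow> agen falg \<Rightarrow> agen falg" where
  "free_act q h x =
    (let D = SU_coprod q x in
     \<Sum>(u, v)\<in>Poly_Mapping.keys D.
       Poly_Mapping.single u (Poly_Mapping.lookup D (u, v) * pairing q h (Poly_Mapping.single v 1)))"

definition act :: "real \<Rightarrow> ugen falg \<Rightarrow> su \<Rightarrow> su" where
  "act q h X = (\<Union>x\<in>X. cls q (free_act q h x))"


section \<open>The \<open>4D\<^sub>+\<close> calculus\<close>

datatype ix = Wm | Wp | W0 | Wz   \<comment> \<open>\<open>\<omega>\<^sub>-\<close>, \<open>\<omega>\<^sub>+\<close>, \<open>\<omega>\<^sub>0\<close>, \<open>\<omega>\<^sub>z\<close>\<close>

lemma UNIV_ix: "UNIV = {Wm, Wp, W0, Wz}"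
  using ix.exhaust by auto

instance ix :: finite
  by standard (simp add: UNIV_ix)

fun LL :: "real \<Rightarrow> ix \<Rightarrow> ugen falg" where
  "LL q Wm = fconst (sqrt q) * FF * Ki"
| "LL q Wp = fconst (1 / sqrt q) * EE * Ki"
| "LL q Wz = fconst (1 / (q - 1 / q)) * (Ki^2 - 1)"
| "LL q W0 = fconst (1 / (q - 1 / q)^2) *
     (fconst q * (KK^2 - 1) + fconst (1 / q) * (Ki^2 - 1)) + FF * EE"

fun ff :: "real \<Rightarrow> ix \<Rightarrow> ix \<Rightarrow> ugen falg" where
  "ff q Wm Wm = 1"
| "ff q Wp Wp = 1"
| "ff q W0 W0 = KK^2"
| "ff q Wz Wz = Ki^2"
| "ff q Wz Wm = fconst (q - 1 / q) * LL q Wm"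
| "ff q Wz Wp = fconst (q - 1 / q) * LL q Wp"
| "ff q Wm W0 = fconst (1 / sqrt q) * KK * EE"
| "ff q Wp W0 = fconst (1 / sqrt q) * FF * KK"
| "ff q Wz W0 = fconst (q - 1 / q) * FF * EE
     + fconst (1 / (q * (q - 1 / q))) * (Ki^2 - KK^2)"
| "ff q _ _ = 0"

text \<open>The elements \<open>f\<^sub>a\<^sub>b\<close> are determined by \<open>\<Delta>(L\<^sub>a) = 1 \<otimes> L\<^sub>a + \<Sum>\<^sub>b L\<^sub>b \<otimes> f\<^sub>b\<^sub>a\<close>. The lemmas
  up to \<open>coproduct_LL\<close> show that \<^const>\<open>ff\<close> satisfies this identity modulo the relations.\<close>

lemma falg_induct [case_names zero single add]:
  fixes x :: "'m \<Rightarrow>\<^sub>0 complex"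
  assumes "P 0" "\<And>k z. P (Poly_Mapping.single k z)" "\<And>x y. P x \<Longrightarrow> P y \<Longrightarrow> P (x + y)"
  shows "P x"
proof (induction x rule: update_induct)
  case const
  show ?case using assms(1) .
next
  case (update f a b)
  have "Poly_Mapping.update a b f = f + Poly_Mapping.single a b"
    using update(1) by (intro poly_mapping_eqI) (auto simp: lookup_update lookup_add lookup_single in_keys_iff when_def)
  then show ?case using assms update by simp
qed

lemma keys_sum_add:
  fixes x y :: "'m \<Rightarrow>\<^sub>0 complex" and h :: "'m \<Rightarrow> complex \<Rightarrow> 'b::comm_monoid_add"
  assumes "\<And>w. h w 0 = 0" "\<And>w a b. h w (a + b) = h w a + h w b"
  shows "(\<Sum>w\<in>Poly_Mapping.keys (x + y). h w (Poly_Mapping.lookup (x + y) w)) =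
    (\<Sum>w\<in>Poly_Mapping.keys x. h w (Poly_Mapping.lookup x w)) +
    (\<Sum>w\<in>Poly_Mapping.keys y. h w (Poly_Mapping.lookup y w))"
proof -
  have *: "(\<Sum>w\<in>Poly_Mapping.keys z. h w (Poly_Mapping.lookup z w)) =
      (\<Sum>w\<in>Poly_Mapping.keys x \<union> Poly_Mapping.keys y. h w (Poly_Mapping.lookup z w))"
    if "Poly_Mapping.keys z \<subseteq> Poly_Mapping.keys x \<union> Poly_Mapping.keys y" for z
    using that by (intro sum.mono_neutral_left) (auto simp: in_keys_iff assms)
  show ?thesis
    by (subst (1 2 3) *) (auto simp: Poly_Mapping.keys_add lookup_add assms sum.distrib)
qed

lemma fconst_add: "fconst (a + b) = fconst a + fconst b"
  by (simp add: fconst_def single_add)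
lemma fconst_mult: "fconst (a * b) = fconst a * fconst b"
  by (simp add: fconst_def mult_single)
lemma fconst_0 [simp]: "fconst 0 = 0" by (simp add: fconst_def)
lemma fconst_1 [simp]: "fconst 1 = 1" by (simp add: fconst_def)
lemma fconst_comm: "x * fconst a = fconst a * x"
  by (induction x rule: falg_induct) (auto simp: fconst_def mult_single algebra_simps)

lemma fhom_add: "fhom \<phi> (x + y) = fhom \<phi> x + fhom \<phi> y"
  unfolding fhom_def by (rule keys_sum_add) (simp_all add: fconst_add algebra_simps)

lemma fhom_single: "fhom \<phi> (Poly_Mapping.single w z) = fconst z * prod_list (map \<phi> w)"
  by (simp add: fhom_def)

lemma fhom_0 [simp]: "fhom \<phi> 0 = 0" by (simp add: fhom_def)

lemma fhom_mult: "fhom \<phi> (x * y) = fhom \<phi> x * fhom \<phi> y"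
proof (induction x rule: falg_induct)
  case (single k z)
  show ?case
  proof (induction y rule: falg_induct)
    case (single l w)
    show ?case
      by (simp add: mult_single fhom_single plus_list_def fconst_mult mult.assoc)
        (metis fconst_comm mult.assoc)
  qed (auto simp: fhom_add algebra_simps)
qed (auto simp: fhom_add algebra_simps)

lemma fhom_uminus: "fhom \<phi> (- x) = - fhom \<phi> x"
  by (metis add.right_inverse add_eq_0_iff fhom_0 fhom_add)
lemma fhom_diff: "fhom \<phi> (x - y) = fhom \<phi> x - fhom \<phi> y"
  by (metis diff_conv_add_uminus fhom_add fhom_uminus)
lemma fhom_fconst: "fhom \<phi> (fconst z) = fconst z"
  by (simp add: fconst_def fhom_single zero_list_def)
lemma fhom_1: "fhom \<phi> 1 = 1" using fhom_fconst[of \<phi> 1] by simp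
lemma fhom_fgen: "fhom \<phi> (fgen g) = \<phi> g"
  by (simp add: fgen_def fhom_single)

lemma ftensor_add_left: "(x + y) \<otimes>\<^sub>f z = x \<otimes>\<^sub>f z + y \<otimes>\<^sub>f z"
  unfolding ftensor_def
  by (rule keys_sum_add[where h="\<lambda>u a. \<Sum>v\<in>Poly_Mapping.keys z. Poly_Mapping.single (u, v) (a * Poly_Mapping.lookup z v)"])
    (simp_all add: algebra_simps single_add sum.distrib)

lemma ftensor_add_right: "z \<otimes>\<^sub>f (x + y) = z \<otimes>\<^sub>f x + z \<otimes>\<^sub>f y"
  unfolding ftensor_def sum.distrib[symmetric]
  by (intro sum.cong refl keys_sum_add[where h="\<lambda>v a. Poly_Mapping.single (_, v) (_ * a)"])
    (simp_all add: algebra_simps single_add)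

lemma ftensor_0 [simp]: "0 \<otimes>\<^sub>f x = 0" "x \<otimes>\<^sub>f 0 = 0"
  by (simp_all add: ftensor_def)

lemma ftensor_single: "Poly_Mapping.single u a \<otimes>\<^sub>f Poly_Mapping.single v b = Poly_Mapping.single (u, v) (a * b)"
  by (simp add: ftensor_def)

lemma ftensor_uminus: "(- x) \<otimes>\<^sub>f y = - (x \<otimes>\<^sub>f y)" "x \<otimes>\<^sub>f (- y) = - (x \<otimes>\<^sub>f y)"
  by (metis add.right_inverse add_eq_0_iff ftensor_0(1) ftensor_add_left,
      metis add.right_inverse add_eq_0_iff ftensor_0(2) ftensor_add_right)
lemma ftensor_diff: "(x - y) \<otimes>\<^sub>f z = x \<otimes>\<^sub>f z - y \<otimes>\<^sub>f z" "z \<otimes>\<^sub>f (x - y) = z \<otimes>\<^sub>f x - z \<otimes>\<^sub>f y"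
  by (simp_all only: diff_conv_add_uminus ftensor_add_left ftensor_add_right ftensor_uminus)

lemma ftensor_mult: "(x \<otimes>\<^sub>f y) * (x' \<otimes>\<^sub>f y') = (x * x') \<otimes>\<^sub>f (y * y')"
proof (induction x rule: falg_induct)
  case (single k z)
  show ?case
  proof (induction y rule: falg_induct)
    case (single l w)
    show ?case
    proof (induction x' rule: falg_induct)
      case (single k' z')
      show ?case
      proof (induction y' rule: falg_induct)
        case (single l' w')
        show ?case
          by (simp add: ftensor_single mult_single mult_ac)
      qed (auto simp: ftensor_add_right algebra_simps)
    qed (auto simp: ftensor_add_left algebra_simps)
  qed (auto simp: ftensor_add_right algebra_simps)
qed (auto simp: ftensor_add_left algebra_simps)

lemma ftensor_fconst: "(fconst z * x) \<otimes>\<^sub>f y = fconst z * (x \<otimes>\<^sub>f y)"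
    "x \<otimes>\<^sub>f (fconst z * y) = fconst z * (x \<otimes>\<^sub>f y)"
    "(x :: 'g falg) \<otimes>\<^sub>f (y :: 'h falg) = (x \<otimes>\<^sub>f 1) * (1 \<otimes>\<^sub>f y)"
    "1 \<otimes>\<^sub>f 1 = (1 :: ('g, 'h) falg2)"
    "(fconst z :: 'g falg) \<otimes>\<^sub>f (y :: 'h falg) = fconst z * ((1 :: 'g falg) \<otimes>\<^sub>f y)" "(x :: 'g falg) \<otimes>\<^sub>f (fconst z :: 'h falg) = fconst z * (x \<otimes>\<^sub>f (1 :: 'h falg))"
proof -
  have a: "fconst z \<otimes>\<^sub>f 1 = (fconst z :: ('g, 'h) falg2)" "1 \<otimes>\<^sub>f fconst z = (fconst z :: ('g, 'h) falg2)" for z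
    by (auto simp: fconst_def ftensor_single zero_prod_def simp flip: single_one)
  show f1: "(fconst z * x) \<otimes>\<^sub>f y = fconst z * (x \<otimes>\<^sub>f y)" for x :: "'g falg" and y :: "'h falg"
    using ftensor_mult[of "fconst z" 1 x y] a by simp
  show f2: "x \<otimes>\<^sub>f (fconst z * y) = fconst z * (x \<otimes>\<^sub>f y)" for x :: "'g falg" and y :: "'h falg"
    using ftensor_mult[of 1 "fconst z" x y] a by simp
  show "(fconst z :: 'g falg) \<otimes>\<^sub>f (y :: 'h falg) = fconst z * ((1 :: 'g falg) \<otimes>\<^sub>f y)" for y :: "'h falg"
    using f1[of 1 y] by simp
  show "(x :: 'g falg) \<otimes>\<^sub>f (fconst z :: 'h falg) = fconst z * (x \<otimes>\<^sub>f (1 :: 'h falg))" for x :: "'g falg"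
    using f2[of x 1] by simp
  show "1 \<otimes>\<^sub>f 1 = (1 :: ('g, 'h) falg2)"
    using a(1)[of 1] by simp
  show "(x :: 'g falg) \<otimes>\<^sub>f (y :: 'h falg) = (x \<otimes>\<^sub>f 1) * (1 \<otimes>\<^sub>f y)"
    by (simp add: ftensor_mult)
qed

lemma ring_ring_of: "ring (ring_of :: 'a::ring_1 ring)"
  by (rule ringI; (rule abelian_groupI)?; (rule monoidI)?)
    (auto simp: ring_of_def algebra_simps intro: exI[of _ "- _"] add.left_inverse)

lemma U2_ideal: "ideal (U2_ideal q) ring_of"
  unfolding U2_ideal_def by (rule ring.genideal_ideal[OF ring_ring_of]) (simp add: ring_of_def)

lemma U2_idealI:
  assumes "r \<in> U_rels q"
  shows "r \<otimes>\<^sub>f y \<in> U2_ideal q" "y \<otimes>\<^sub>f r \<in> U2_ideal q"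
proof -
  have sub: "(\<lambda>r. r \<otimes>\<^sub>f 1) ` U_rels q \<union> (\<lambda>r. 1 \<otimes>\<^sub>f r) ` U_rels q \<subseteq> U2_ideal q"
    unfolding U2_ideal_def by (rule ring.genideal_self[OF ring_ring_of]) (simp add: ring_of_def)
  have "(r \<otimes>\<^sub>f 1) * (1 \<otimes>\<^sub>f y) \<in> U2_ideal q"
    using ideal.I_r_closed[OF U2_ideal, of "r \<otimes>\<^sub>f 1" q "1 \<otimes>\<^sub>f y"] sub assms by (auto simp: ring_of_def)
  moreover have "(y \<otimes>\<^sub>f 1) * (1 \<otimes>\<^sub>f r) \<in> U2_ideal q"
    using ideal.I_l_closed[OF U2_ideal, of "1 \<otimes>\<^sub>f r" q "y \<otimes>\<^sub>f 1"] sub assms by (auto simp: ring_of_def)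
  ultimately show "r \<otimes>\<^sub>f y \<in> U2_ideal q" "y \<otimes>\<^sub>f r \<in> U2_ideal q"
    by (simp_all add: ftensor_mult)
qed

lemma U2_ideal_closed: "x \<in> U2_ideal q \<Longrightarrow> y * x \<in> U2_ideal q" "0 \<in> U2_ideal q"
  using ideal.I_l_closed[OF U2_ideal, of x q y] additive_subgroup.zero_closed[OF ideal.axioms(1)[OF U2_ideal, of q]]
  by (auto simp: ring_of_def)

lemmas fhom_simps = fhom_add fhom_mult fhom_diff fhom_uminus fhom_fconst fhom_1 fhom_fgen
lemmas ft_simps = ftensor_add_left ftensor_add_right ftensor_diff ftensor_uminus ftensor_fconst(1,2,4-6) ftensor_mult

lemma coproduct_LL:
  assumes "0 < q" "q < 1"
  shows "U_coprod (LL q a) - (1 \<otimes>\<^sub>f LL q a + (\<Sum>b\<in>UNIV. LL q b \<otimes>\<^sub>f ff q b a)) \<in> U2_ideal q"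
proof -
  define l where "l = complex_of_real q - 1 / complex_of_real q"
  have "q - 1 / q \<noteq> 0"
    using assms by (simp add: field_simps) (metis abs_square_eq_1 abs_of_pos less_irrefl power2_eq_square)
  then have l0: "l \<noteq> 0" unfolding l_def by (metis of_real_1 of_real_diff of_real_divide of_real_eq_0_iff)
  define s where "s = complex_of_real (sqrt q)"
  have s0: "s \<noteq> 0" and ss: "s * s = complex_of_real q" using assms by (auto simp: s_def simp flip: of_real_mult)
  have r1: "KK * Ki - 1 \<in> U_rels q" and r2: "Ki * EE - fconst (1 / q) * EE * Ki \<in> U_rels q"
    by (auto simp: U_rels_def)
  note A = fhom_simps ft_simps UNIV_ix power2_eq_square U_coprod_def
  have cc: "fconst a * (fconst b * x) = fconst (a * b) * x" "fconst a * fconst b = fconst (a * b)" for a b and x :: "(ugen,ugen) falg2"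
    by (simp_all add: fconst_mult mult.assoc)
  have cm: "x * (fconst a * y) = fconst a * (x * y)" for a and x y :: "(ugen,ugen) falg2"
    by (metis fconst_comm mult.assoc)
  have l': "fconst l * (fconst (1 / l) * x) = x" for x :: "(ugen,ugen) falg2"
    using l0 by (simp add: mult.assoc[symmetric] flip: fconst_mult)
  have l'': "fconst (1/l) * (fconst l * x) = x" for x :: "(ugen,ugen) falg2"
    using l0 by (simp add: mult.assoc[symmetric] flip: fconst_mult)
  show ?thesis
  proof (cases a)
    case Wm
    have "U_coprod (LL q a) - (1 \<otimes>\<^sub>f LL q a + (\<Sum>b\<in>UNIV. LL q b \<otimes>\<^sub>f ff q b a))
       = fconst s * ((FF * Ki) \<otimes>\<^sub>f (KK * Ki - 1))"
      by (simp add: Wm A algebra_simps l0 s0 cc flip: l_def s_def)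
    then show ?thesis using U2_idealI(2)[OF r1] U2_ideal_closed by metis
  next
    case Wp
    have "U_coprod (LL q a) - (1 \<otimes>\<^sub>f LL q a + (\<Sum>b\<in>UNIV. LL q b \<otimes>\<^sub>f ff q b a))
       = fconst (1 / s) * ((EE * Ki) \<otimes>\<^sub>f (KK * Ki - 1))"
      by (simp add: Wp A algebra_simps l0 s0 cc flip: l_def s_def)
    then show ?thesis using U2_idealI(2)[OF r1] U2_ideal_closed by metis
  next
    case Wz
    have "U_coprod (LL q a) - (1 \<otimes>\<^sub>f LL q a + (\<Sum>b\<in>UNIV. LL q b \<otimes>\<^sub>f ff q b a)) = 0"
      by (simp add: Wz A algebra_simps l0 s0 cc flip: l_def s_def)
    then show ?thesis using U2_ideal_closed by metis
  next
    case W0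
    define \<alpha> \<beta> \<delta> where "\<alpha> = complex_of_real q / l^2" and "\<beta> = 1 / (complex_of_real q * l^2)"
      and "\<delta> = 1 / (complex_of_real q * l)"
    have q0: "complex_of_real q \<noteq> 0" using assms by simp
    have "1 / l * l = 1" "l * (1 / l) = 1" "s * (1 / s) = 1" "1 / s * s = 1"
      using l0 s0 by simp_all
    moreover have "1 / l * \<delta> = \<beta>" "\<delta> * (1 / l) = \<beta>"
      by (simp_all add: \<beta>_def \<delta>_def power2_eq_square mult_ac)
    moreover have "1 / s * (1 / s) = 1 / complex_of_real q"
      by (simp flip: ss)
    ultimately have sc: "1 / l * l = 1" "l * (1 / l) = 1" "s * (1 / s) = 1" "1 / s * s = 1"
      "1 / l * \<delta> = \<beta>" "\<delta> * (1 / l) = \<beta>" "1 / s * (1 / s) = 1 / complex_of_real q"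
      by blast+
    have L0: "LL q W0 = fconst \<alpha> * (KK * KK) + fconst \<beta> * (Ki * Ki) - fconst \<alpha> - fconst \<beta> + FF * EE"
    proof -
      have "fconst \<alpha> = fconst (1 / l^2) * (fconst q :: ugen falg)"
        "fconst \<beta> = fconst (1 / l^2) * (fconst (1 / q) :: ugen falg)"
        by (simp_all add: \<alpha>_def \<beta>_def mult.commute flip: fconst_mult)
      moreover have "LL q W0 = fconst (1 / l^2) * (fconst q * (KK * KK - 1) + fconst (1 / q) * (Ki * Ki - 1)) + FF * EE"
        by (simp only: LL.simps power2_eq_square l_def of_real_divide of_real_diff of_real_mult of_real_1)
      ultimately show ?thesis
        by (simp add: distrib_left right_diff_distrib mult.assoc)
    qed
    have Lz: "LL q Wz = fconst (1 / l) * (Ki * Ki - 1)" and Lm: "LL q Wm = fconst s * (FF * Ki)"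
      and Lp: "LL q Wp = fconst (1 / s) * (EE * Ki)"
      by (simp_all add: power2_eq_square mult.assoc l_def s_def)
    have f: "ff q W0 W0 = KK * KK" "ff q Wm W0 = fconst (1 / s) * (KK * EE)"
        "ff q Wp W0 = fconst (1 / s) * (FF * KK)"
        "ff q Wz W0 = fconst l * (FF * EE) + fconst \<delta> * (Ki * Ki - KK * KK)"
      by (simp_all add: power2_eq_square mult.assoc l_def s_def \<delta>_def)
    have D: "U_coprod (LL q W0) = fconst \<alpha> * ((KK * KK) \<otimes>\<^sub>f (KK * KK)) + fconst \<beta> * ((Ki * Ki) \<otimes>\<^sub>f (Ki * Ki))
        - fconst \<alpha> - fconst \<beta> + ((FF * EE) \<otimes>\<^sub>f (KK * KK) + (FF * Ki) \<otimes>\<^sub>f (KK * EE)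
        + (Ki * EE) \<otimes>\<^sub>f (FF * KK) + (Ki * Ki) \<otimes>\<^sub>f (FF * EE))"
      unfolding L0 U_coprod_def
      by (simp only: fhom_simps U_coprod_gen.simps ftensor_mult distrib_left distrib_right)
        (simp only: add.assoc add.left_commute add.commute)
    have T1: "1 \<otimes>\<^sub>f LL q W0 = fconst \<alpha> * (1 \<otimes>\<^sub>f (KK * KK)) + fconst \<beta> * (1 \<otimes>\<^sub>f (Ki * Ki))
        - fconst \<alpha> - fconst \<beta> + (1 :: ugen falg) \<otimes>\<^sub>f (FF * EE)"
      unfolding L0 by (simp only: ft_simps mult_1_right)
    have T2: "LL q W0 \<otimes>\<^sub>f ff q W0 W0 = fconst \<alpha> * ((KK * KK) \<otimes>\<^sub>f (KK * KK))
        + fconst \<beta> * ((Ki * Ki) \<otimes>\<^sub>f (KK * KK))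
        - fconst \<alpha> * (1 \<otimes>\<^sub>f (KK * KK)) - fconst \<beta> * (1 \<otimes>\<^sub>f (KK * KK)) + (FF * EE) \<otimes>\<^sub>f (KK * KK)"
      unfolding L0 f by (simp only: ft_simps)
    have T3: "LL q Wm \<otimes>\<^sub>f ff q Wm W0 = (FF * Ki) \<otimes>\<^sub>f (KK * EE)"
      unfolding Lm f by (simp only: ftensor_fconst(1,2) cc sc fconst_1 mult_1_left)
    have T4: "LL q Wp \<otimes>\<^sub>f ff q Wp W0 = fconst (1 / q) * ((EE * Ki) \<otimes>\<^sub>f (FF * KK))"
      unfolding Lp f by (simp only: ftensor_fconst(1,2) cc sc of_real_divide of_real_1)
    have T5: "LL q Wz \<otimes>\<^sub>f ff q Wz W0 = (Ki * Ki) \<otimes>\<^sub>f (FF * EE) - 1 \<otimes>\<^sub>f (FF * EE)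
        + fconst \<beta> * ((Ki * Ki) \<otimes>\<^sub>f (Ki * Ki)) - fconst \<beta> * ((Ki * Ki) \<otimes>\<^sub>f (KK * KK))
        - fconst \<beta> * (1 \<otimes>\<^sub>f (Ki * Ki)) + fconst \<beta> * (1 \<otimes>\<^sub>f (KK * KK))"
    proof -
      have "LL q Wz \<otimes>\<^sub>f ff q Wz W0 =
          (Ki * Ki - 1) \<otimes>\<^sub>f (FF * EE) + fconst \<beta> * ((Ki * Ki - 1) \<otimes>\<^sub>f (Ki * Ki - KK * KK))"
        unfolding Lz f
        by (simp only: ftensor_fconst(1,2) ftensor_add_right distrib_left cc sc fconst_1 mult_1_left)
      then show ?thesis
        by (simp only: ftensor_diff right_diff_distrib) (simp only: algebra_simps)
    qed
    have R: "(Ki * EE - fconst (1 / q) * EE * Ki) \<otimes>\<^sub>f (FF * KK) =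
        (Ki * EE) \<otimes>\<^sub>f (FF * KK) - fconst (1 / q) * ((EE * Ki) \<otimes>\<^sub>f (FF * KK))"
      by (simp only: ftensor_diff ftensor_fconst(1,2) mult.assoc)
    have S: "(\<Sum>b\<in>UNIV. LL q b \<otimes>\<^sub>f ff q b W0) = LL q Wm \<otimes>\<^sub>f ff q Wm W0 + LL q Wp \<otimes>\<^sub>f ff q Wp W0
        + LL q W0 \<otimes>\<^sub>f ff q W0 W0 + LL q Wz \<otimes>\<^sub>f ff q Wz W0"
      by (simp only: UNIV_ix) (simp del: LL.simps ff.simps)
    have "U_coprod (LL q a) - (1 \<otimes>\<^sub>f LL q a + (\<Sum>b\<in>UNIV. LL q b \<otimes>\<^sub>f ff q b a)) =
       (Ki * EE - fconst (1 / q) * EE * Ki) \<otimes>\<^sub>f (FF * KK)"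
      unfolding W0 S D T1 T2 T3 T4 T5 R by simp
    then show ?thesis using U2_idealI(1)[OF r2] by metis
  qed
qed

text \<open>\<open>\<Omega>\<^sup>\<otimes>\<^sup>k\<close>: as \<open>\<Omega>\<^sup>1\<close> is free as a left module on the \<open>\<omega>\<^sub>a\<close>, its \<open>k\<close>-fold tensor power over the
  algebra is free as a left module on the \<open>\<omega>\<^bsub>a\<^sub>1\<^esub> \<otimes> \<dots> \<otimes> \<omega>\<^bsub>a\<^sub>k\<^esub>\<close>, and an element is
  represented by its left coefficients, extended by zero to all words.\<close>

type_synonym form = "ix list \<Rightarrow> su"

definition words :: "nat \<Rightarrow> ix list set" where
  "words k = {I. length I = k}"

definition \<Omega> :: "real \<Rightarrow> nat \<Rightarrow> form set" where
  "\<Omega> q k = {\<phi>. (\<forall>I\<in>words k. \<phi> I \<in> carrier (SU q)) \<and> (\<forall>I. I \<notin> words k \<longrightarrow> \<phi> I = \<zero>\<^bsub>SU q\<^esub>)}"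

definition \<omega> :: "real \<Rightarrow> ix list \<Rightarrow> form" where
  "\<omega> q I = (\<lambda>J. if J = I then \<one>\<^bsub>SU q\<^esub> else \<zero>\<^bsub>SU q\<^esub>)"

definition form_zero :: "real \<Rightarrow> form" where
  "form_zero q = (\<lambda>J. \<zero>\<^bsub>SU q\<^esub>)"

definition form_add :: "real \<Rightarrow> form \<Rightarrow> form \<Rightarrow> form" where
  "form_add q \<phi> \<psi> = (\<lambda>J. \<phi> J \<oplus>\<^bsub>SU q\<^esub> \<psi> J)"

text \<open>\<open>\<omega>\<^sub>I x = \<Sum>\<^sub>J (move q I J x) \<omega>\<^sub>J\<close>, iterating \<open>\<omega>\<^sub>a x = \<Sum>\<^sub>b (f\<^sub>a\<^sub>b \<triangleright> x) \<omega>\<^sub>b\<close>.\<close>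

fun move :: "real \<Rightarrow> ix list \<Rightarrow> ix list \<Rightarrow> su \<Rightarrow> su" where
  "move q [] [] x = x"
| "move q (a # I) (b # J) x = act q (ff q a b) (move q I J x)"
| "move q _ _ x = \<zero>\<^bsub>SU q\<^esub>"

definition lmult :: "real \<Rightarrow> su \<Rightarrow> form \<Rightarrow> form" where
  "lmult q x \<phi> = (\<lambda>J. x \<otimes>\<^bsub>SU q\<^esub> \<phi> J)"

definition rmult :: "real \<Rightarrow> form \<Rightarrow> su \<Rightarrow> form" where
  "rmult q \<phi> x = (\<lambda>J. \<Oplus>\<^bsub>SU q\<^esub> I\<in>words (length J). \<phi> I \<otimes>\<^bsub>SU q\<^esub> move q I J x)"

text \<open>\<open>\<phi> \<otimes> \<psi>\<close> for \<open>\<phi>\<close> of degree \<open>k\<close>: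
  \<open>(x \<omega>\<^sub>I) \<otimes> (y \<omega>\<^sub>J) = x (\<omega>\<^sub>I y) \<otimes> \<omega>\<^sub>J\<close>.\<close>

definition tens :: "real \<Rightarrow> nat \<Rightarrow> form \<Rightarrow> form \<Rightarrow> form" where
  "tens q k \<phi> \<psi> = (\<lambda>J. \<Oplus>\<^bsub>SU q\<^esub> I\<in>words k.
     \<phi> I \<otimes>\<^bsub>SU q\<^esub> move q I (take k J) (\<psi> (drop k J)))"

text \<open>The left-linear map on \<open>\<Omega>\<^sup>\<otimes>\<^sup>k\<close> with \<open>\<omega>\<^sub>I \<mapsto> T I\<close>.\<close>

definition lin_ext :: "real \<Rightarrow> nat \<Rightarrow> (ix list \<Rightarrow> form) \<Rightarrow> form \<Rightarrow> form" where
  "lin_ext q k T \<phi> = (\<lambda>J. \<Oplus>\<^bsub>SU q\<^esub> I\<in>words k. \<phi> I \<otimes>\<^bsub>SU q\<^esub> T I J)"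

fun bar :: "ix \<Rightarrow> ix" where
  "bar Wm = Wp" | "bar Wp = Wm" | "bar W0 = W0" | "bar Wz = Wz"

text \<open>The involution on 1-forms: \<open>(x \<omega>\<^sub>a)\<^sup>* = \<omega>\<^sub>a\<^sup>* x\<^sup>*\<close> with \<open>\<omega>\<^sub>a\<^sup>* = - \<omega>\<^bsub>bar a\<^esub>\<close>.\<close>

definition form_star :: "real \<Rightarrow> form \<Rightarrow> form" where
  "form_star q \<phi> = (\<lambda>J. \<Oplus>\<^bsub>SU q\<^esub> a\<in>UNIV.
     rmult q (lmult q (scal q (- 1)) (\<omega> q [bar a])) (su_star (\<phi> [a])) J)"

fun sigma_terms :: "real \<Rightarrow> ix \<Rightarrow> ix \<Rightarrow> (complex \<times> ix list) list" where
  "sigma_terms q Wm Wm = [(1, [Wm, Wm])]"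
| "sigma_terms q Wp Wp = [(1, [Wp, Wp])]"
| "sigma_terms q W0 W0 = [(1, [W0, W0])]"
| "sigma_terms q Wm W0 = [(1 - q^2, [Wm, W0]), (1, [W0, Wm])]"
| "sigma_terms q W0 Wm = [(q^2, [Wm, W0])]"
| "sigma_terms q Wm Wz = [(1 + q^2, [Wm, W0]), (1, [Wz, Wm])]"
| "sigma_terms q Wz Wm = [(- (1 + 1 / q^2), [Wm, W0]), (1 / q^2, [Wm, Wz]), (1 - 1 / q^2, [Wz, Wm])]"
| "sigma_terms q Wp W0 = [(1 - 1 / q^2, [Wp, W0]), (1, [W0, Wp])]"
| "sigma_terms q W0 Wp = [(1 / q^2, [Wp, W0])]"
| "sigma_terms q Wp Wz = [(- (1 + 1 / q^2), [Wp, W0]), (1, [Wz, Wp])]"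
| "sigma_terms q Wz Wp = [(1 + q^2, [Wp, W0]), (q^2, [Wp, Wz]), (1 - q^2, [Wz, Wp])]"
| "sigma_terms q Wz W0 = [(1, [W0, Wz]),
     (- ((q - 1 / q)^2), [Wz, W0]), (- ((q - 1 / q)^2), [Wm, Wp]), ((q - 1 / q)^2, [Wp, Wm])]"
| "sigma_terms q W0 Wz = [(1, [Wz, W0])]"
| "sigma_terms q Wz Wz = [(1, [Wz, Wz]),
     (q^2 - 1 / q^2, [Wz, W0]), (q^2 - 1 / q^2, [Wm, Wp]), (- (q^2 - 1 / q^2), [Wp, Wm])]"
| "sigma_terms q Wm Wp = [(- 1, [Wz, W0]), (1, [Wp, Wm])]"
| "sigma_terms q Wp Wm = [(1, [Wz, W0]), (1, [Wm, Wp])]"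

definition sigma_basis :: "real \<Rightarrow> ix list \<Rightarrow> form" where
  "sigma_basis q I = (\<lambda>J. scal q
     (\<Sum>(z, K)\<leftarrow>sigma_terms q (I ! 0) (I ! 1). if K = J then z else 0))"

definition \<sigma> :: "real \<Rightarrow> form \<Rightarrow> form" where
  "\<sigma> q = lin_ext q 2 (sigma_basis q)"

definition \<sigma>1 :: "real \<Rightarrow> form \<Rightarrow> form" where
  "\<sigma>1 q = lin_ext q 3 (\<lambda>I. tens q 2 (\<sigma> q (\<omega> q (take 2 I))) (\<omega> q (drop 2 I)))"

definition \<sigma>2 :: "real \<Rightarrow> form \<Rightarrow> form" where
  "\<sigma>2 q = lin_ext q 3 (\<lambda>I. tens q 1 (\<omega> q (take 1 I)) (\<sigma> q (\<omega> q (drop 1 I))))"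


section \<open>Metrics compatible with the braiding\<close>

type_synonym metric = "form \<Rightarrow> su"

text \<open>\<open>g \<otimes> 1\<close> and \<open>1 \<otimes> g\<close> from the third to the first tensor power.\<close>

definition metric_id :: "real \<Rightarrow> metric \<Rightarrow> form \<Rightarrow> form" where
  "metric_id q g = lin_ext q 3 (\<lambda>I. lmult q (g (\<omega> q (take 2 I))) (\<omega> q (drop 2 I)))"

definition id_metric :: "real \<Rightarrow> metric \<Rightarrow> form \<Rightarrow> form" where
  "id_metric q g = lin_ext q 3 (\<lambda>I. rmult q (\<omega> q (take 1 I)) (g (\<omega> q (drop 1 I))))"

definition bimodule_hom :: "real \<Rightarrow> metric \<Rightarrow> bool" where
  "bimodule_hom q g \<longleftrightarrow>
     g \<in> \<Omega> q 2 \<rightarrow> carrier (SU q) \<and>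
     (\<forall>\<Phi>\<in>\<Omega> q 2. \<forall>\<Psi>\<in>\<Omega> q 2. g (form_add q \<Phi> \<Psi>) = g \<Phi> \<oplus>\<^bsub>SU q\<^esub> g \<Psi>) \<and>
     (\<forall>x\<in>carrier (SU q). \<forall>\<Phi>\<in>\<Omega> q 2. g (lmult q x \<Phi>) = x \<otimes>\<^bsub>SU q\<^esub> g \<Phi>) \<and>
     (\<forall>x\<in>carrier (SU q). \<forall>\<Phi>\<in>\<Omega> q 2. g (rmult q \<Phi> x) = g \<Phi> \<otimes>\<^bsub>SU q\<^esub> x)"

definition nondegenerate :: "real \<Rightarrow> metric \<Rightarrow> bool" where
  "nondegenerate q g \<longleftrightarrow>
     (\<forall>\<phi>\<in>\<Omega> q 1. (\<forall>\<psi>\<in>\<Omega> q 1. g (tens q 1 \<phi> \<psi>) = \<zero>\<^bsub>SU q\<^esub>) \<longrightarrow> \<phi> = form_zero q) \<and>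
     (\<forall>\<psi>\<in>\<Omega> q 1. (\<forall>\<phi>\<in>\<Omega> q 1. g (tens q 1 \<phi> \<psi>) = \<zero>\<^bsub>SU q\<^esub>) \<longrightarrow> \<psi> = form_zero q)"

definition sigma_metric :: "real \<Rightarrow> metric \<Rightarrow> bool" where
  "sigma_metric q g \<longleftrightarrow>
     bimodule_hom q g \<and>
     nondegenerate q g \<and>
     (\<forall>\<Phi>\<in>\<Omega> q 2. g (\<sigma> q \<Phi>) = g \<Phi>) \<and>
     (\<forall>\<Phi>\<in>\<Omega> q 2. g (inv_into (\<Omega> q 2) (\<sigma> q) \<Phi>) = g \<Phi>) \<and>
     (\<forall>\<Phi>\<in>\<Omega> q 3. metric_id q g (\<sigma>2 q \<Phi>) = id_metric q g (inv_into (\<Omega> q 3) (\<sigma>1 q) \<Phi>)) \<and>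
     (\<forall>\<Phi>\<in>\<Omega> q 3. metric_id q g (inv_into (\<Omega> q 3) (\<sigma>2 q) \<Phi>) = id_metric q g (\<sigma>1 q \<Phi>))"

definition real_metric :: "real \<Rightarrow> metric \<Rightarrow> bool" where
  "real_metric q g \<longleftrightarrow> (\<forall>\<phi>\<in>\<Omega> q 1. \<forall>\<phi>'\<in>\<Omega> q 1.
     su_star (g (tens q 1 \<phi> \<phi>')) = g (tens q 1 (form_star q \<phi>') (form_star q \<phi>)))"

text \<open>The weights matter only through \<open>n\<^sub>0 = n\<^sub>z = 0\<close> and \<open>n\<^sub>- = - n\<^sub>+ \<noteq> 0\<close>.\<close>

fun U1_weight :: "ix \<Rightarrow> int" where
  "U1_weight Wm = 1" | "U1_weight Wp = - 1" | "U1_weight W0 = 0" | "U1_weight Wz = 0"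

definition U1_coinvariant :: "real \<Rightarrow> metric \<Rightarrow> bool" where
  "U1_coinvariant q g \<longleftrightarrow> (\<forall>a b. U1_weight a + U1_weight b \<noteq> 0 \<longrightarrow>
     g (tens q 1 (\<omega> q [a]) (\<omega> q [b])) = \<zero>\<^bsub>SU q\<^esub>)"

definition G_sigma :: "real \<Rightarrow> metric set" where
  "G_sigma q = {g. sigma_metric q g \<and> real_metric q g \<and>
     (\<forall>a b. g (tens q 1 (\<omega> q [a]) (\<omega> q [b])) \<in> range (scal q)) \<and>
     U1_coinvariant q g}"


section \<open>Forms on left-invariant 1-forms\<close>

text \<open>A left-invariant 1-form is given by its complex coordinates with respect to the \<open>\<omega>\<^sub>a\<close>.\<close>

type_synonym invform = "ix \<Rightarrow> complex"

definition inv_emb :: "real \<Rightarrow> invform \<Rightarrow> form" where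
  "inv_emb q u = (\<lambda>J. case J of [a] \<Rightarrow> scal q (u a) | _ \<Rightarrow> \<zero>\<^bsub>SU q\<^esub>)"

definition inv_star :: "invform \<Rightarrow> invform" where
  "inv_star u = (\<lambda>a. - cnj (u (bar a)))"

fun g_matrix :: "real \<Rightarrow> real \<Rightarrow> real \<Rightarrow> ix \<Rightarrow> ix \<Rightarrow> real" where
  "g_matrix q s a Wm Wp = q^2 * a"
| "g_matrix q s a Wp Wm = a"
| "g_matrix q s a W0 Wz = s * (1 - q^2) * a"
| "g_matrix q s a Wz W0 = s * (1 - q^2) * a"
| "g_matrix q s a Wz Wz = s * (1 + q^2) * a"
| "g_matrix q s a _ _ = 0"

definition g_tilde :: "real \<Rightarrow> real \<Rightarrow> real \<Rightarrow> invform \<Rightarrow> invform \<Rightarrow> complex" where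
  "g_tilde q s a u v = (\<Sum>i\<in>UNIV. \<Sum>j\<in>UNIV. u i * g_matrix q s a i j * v j)"

definition G_forms :: "real \<Rightarrow> (invform \<Rightarrow> invform \<Rightarrow> complex) set" where
  "G_forms q = {g_tilde q s a | s a. s \<in> {1, - 1} \<and> a \<noteq> 0}"

fun Gamma_matrix :: "real \<Rightarrow> real \<Rightarrow> ix \<Rightarrow> ix \<Rightarrow> real" where
  "Gamma_matrix q \<alpha> Wm Wm = \<alpha>"
| "Gamma_matrix q \<alpha> Wp Wp = q^2 * \<alpha>"
| "Gamma_matrix q \<alpha> W0 Wz = (1 - q^2) * \<alpha>"
| "Gamma_matrix q \<alpha> Wz W0 = (1 - q^2) * \<alpha>"
| "Gamma_matrix q \<alpha> Wz Wz = (1 + q^2) * \<alpha>"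
| "Gamma_matrix q \<alpha> _ _ = 0"

definition Gamma_form :: "real \<Rightarrow> real \<Rightarrow> invform \<Rightarrow> invform \<Rightarrow> complex" where
  "Gamma_form q \<alpha> u v = (\<Sum>i\<in>UNIV. \<Sum>j\<in>UNIV. cnj (u i) * Gamma_matrix q \<alpha> i j * v j)"

definition restricts_to :: "real \<Rightarrow> metric \<Rightarrow> (invform \<Rightarrow> invform \<Rightarrow> complex) \<Rightarrow> bool" where
  "restricts_to q g b \<longleftrightarrow> (\<forall>u v. g (tens q 1 (inv_emb q u) (inv_emb q v)) = scal q (b u v))"

end

(*
  The action of the enveloping algebra preserves the relations of SU_q(2), since K, K^-1, E, F act
  as automorphisms and twisted derivations whose values on the relations are again combinations of
  relations; on scalars it reduces to the counit, and the counit f_ab is the Kronecker delta. Hence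
  every condition on a metric with constant coefficients G_ab becomes a linear equation over the
  complex numbers. Composing the compatibility (g (x) 1) sigma_2 = (1 (x) g) sigma_1^-1 with sigma_1
  gives (g (x) 1) sigma_2 sigma_1 = 1 (x) g. With coinvariance, its components at -+0, -+z and -0+
  express G_z0, G_zz and G_0z through G_-+ and G_+-, and G_0z = G_z0 fixes the ratio of the latter.
  G_00 is killed by right linearity, reality makes G_+- real and nondegeneracy makes it nonzero.
*)

theory Submission
  imports Defs
begin

section \<open>The left action on the free algebra\<close>

text \<open>Cosets are handled through representatives in the free algebra. That the quotient does
  not collapse is seen through the counit: it kills all relations, so scalars embed, and a scalar
  multiple of the generator \<open>a\<close> vanishes only for the scalar zero. The pairing is a
  recursion over words, and stripping a letter off a word changes the functional with which the next
  leg is contracted. The action is therefore set up for arbitrary functionals on words, where it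
  becomes closed under this recursion. The inverse in the compatibility condition is the main
  obstacle. It is an \<open>inv_into\<close>, which selects a preimage among all forms with
  coefficients in the algebra, so it can be cancelled only once \<open>\<sigma>1\<close> is known to
  be injective on the whole module. An explicit inverse of the scalar matrix of the braiding
  provides this, because scalars are central. The upper sign is forced by the factors 1 - q^2 and 1
  + q^2 with which \<open>G Wz W0\<close> and \<open>G Wz Wz\<close> are multiples of
  \<open>G Wp Wm\<close>.\<close>

lemma single_eq_fconst_mult: "Poly_Mapping.single (k :: 'm::monoid_add) (z * w) = fconst z * Poly_Mapping.single k w"
  by (simp add: fconst_def mult_single)

lemma single_Cons: "Poly_Mapping.single (a # w) z = fgen a * Poly_Mapping.single w z"
  by (simp add: fgen_def mult_single plus_list_def)

lemma single_Nil: "Poly_Mapping.single [] z = fconst z"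
  by (simp add: fconst_def zero_list_def)

lemma fconst_mult_fconst_mult: "fconst a * (fconst b * x) = fconst (a * b) * x"
  by (simp add: fconst_mult mult.assoc)

lemma mult_fconst_mult: "x * (fconst a * y) = fconst a * (x * y)"
  by (metis fconst_comm mult.assoc)

lemma fconst_uminus: "fconst (- a) = - fconst a"
  by (simp add: fconst_def single_uminus)

lemma fconst_diff: "fconst (a - b) = fconst a - fconst b"
  by (simp add: fconst_def single_diff)

lemma fconst_inject: "fconst a = fconst b \<longleftrightarrow> a = b"
  by (metis fconst_def lookup_single_eq)

text \<open>Words grow by a letter on the left, the side on which \<open>SU_coprod\<close> and
  \<open>pair_gen\<close> recurse.\<close>

lemma falg_word_induct [case_names zero one Cons add scale]:
  fixes x :: "'g falg"
  assumes "P 0" "P 1" "\<And>g x. P x \<Longrightarrow> P (fgen g * x)"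
    "\<And>x y. P x \<Longrightarrow> P y \<Longrightarrow> P (x + y)" "\<And>z x. P x \<Longrightarrow> P (fconst z * x)"
  shows "P x"
proof (induction x rule: falg_induct)
  case (single k z)
  have "P (Poly_Mapping.single k 1)"
    by (induction k) (auto simp: single_Nil single_Cons assms)
  then show ?case
    using assms(5)[of "Poly_Mapping.single k 1" z] by (simp flip: single_eq_fconst_mult)
qed (auto simp: assms)

text \<open>\<open>slice \<phi>\<close> is \<open>id \<otimes> \<phi>\<close> and \<open>eval2 \<phi> \<psi>\<close> is \<open>\<phi> \<otimes> \<psi>\<close>, for linear functionals given by
  their values on words.\<close>

definition slice :: "('h list \<Rightarrow> complex) \<Rightarrow> ('g, 'h) falg2 \<Rightarrow> 'g falg" where
  "slice \<phi> D = (\<Sum>p\<in>Poly_Mapping.keys D.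
     Poly_Mapping.single (fst p) (Poly_Mapping.lookup D p * \<phi> (snd p)))"

definition eval2 :: "('g list \<Rightarrow> complex) \<Rightarrow> ('h list \<Rightarrow> complex) \<Rightarrow> ('g, 'h) falg2 \<Rightarrow> complex" where
  "eval2 \<phi> \<psi> D = (\<Sum>p\<in>Poly_Mapping.keys D. Poly_Mapping.lookup D p * \<phi> (fst p) * \<psi> (snd p))"

lemma slice_add: "slice \<phi> (x + y) = slice \<phi> x + slice \<phi> y"
  unfolding slice_def
  by (rule keys_sum_add[where h="\<lambda>p a. Poly_Mapping.single (fst p) (a * \<phi> (snd p))"])
    (simp_all add: algebra_simps single_add)

lemma slice_0 [simp]: "slice \<phi> 0 = 0"
  by (simp add: slice_def)

lemma slice_uminus: "slice \<phi> (- x) = - slice \<phi> x"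
  by (metis add.right_inverse add_eq_0_iff slice_0 slice_add)

lemma slice_diff: "slice \<phi> (x - y) = slice \<phi> x - slice \<phi> y"
  by (metis diff_conv_add_uminus slice_add slice_uminus)

lemma slice_single: "slice \<phi> (Poly_Mapping.single (u, v) z) = Poly_Mapping.single u (z * \<phi> v)"
  by (simp add: slice_def)

lemma slice_fconst: "slice \<phi> (fconst z * D) = fconst z * slice \<phi> D"
  by (induction D rule: falg_induct)
    (auto simp: slice_add distrib_left mult_single fconst_def slice_single mult.assoc)

text \<open>The letter of the second leg is absorbed by the functional, that of the first leg comes
  out as a factor. This shift of functionals drives all later recursions.\<close>

lemma slice_fgen: "slice \<phi> ((fgen l \<otimes>\<^sub>f fgen r) * D) = fgen l * slice (\<lambda>v. \<phi> (r # v)) D"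
proof (induction D rule: falg_induct)
  case (single p z)
  show ?case
    by (cases p) (simp add: fgen_def ftensor_single mult_single slice_single plus_list_def)
qed (auto simp: slice_add distrib_left)

lemma slice_functional_add: "slice (\<lambda>v. \<phi> v + \<psi> v) D = slice \<phi> D + slice \<psi> D"
  by (simp add: slice_def distrib_left single_add sum.distrib)

lemma slice_functional_scale: "slice (\<lambda>v. z * \<phi> v) D = fconst z * slice \<phi> D"
  by (simp add: slice_def sum_distrib_left fconst_def mult_single mult_ac)

lemma slice_functional_0 [simp]: "slice (\<lambda>v. 0) D = 0"
  by (simp add: slice_def)

lemma slice_functional_uminus: "slice (\<lambda>v. - \<phi> v) D = - slice \<phi> D"
  using slice_functional_scale[of "- 1" \<phi> D] by (simp add: fconst_uminus)

lemma slice_functional_diff: "slice (\<lambda>v. \<phi> v - \<psi> v) D = slice \<phi> D - slice \<psi> D"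
  using slice_functional_add[of \<phi> "\<lambda>v. - \<psi> v" D] by (simp add: slice_functional_uminus)

lemma eval2_add: "eval2 \<phi> \<psi> (x + y) = eval2 \<phi> \<psi> x + eval2 \<phi> \<psi> y"
  unfolding eval2_def
  by (rule keys_sum_add[where h="\<lambda>p a. a * \<phi> (fst p) * \<psi> (snd p)"])
    (simp_all add: algebra_simps)

lemma eval2_0 [simp]: "eval2 \<phi> \<psi> 0 = 0"
  by (simp add: eval2_def)

lemma eval2_single: "eval2 \<phi> \<psi> (Poly_Mapping.single (u, v) z) = z * \<phi> u * \<psi> v"
  by (simp add: eval2_def)

lemma eval2_diff: "eval2 \<phi> \<psi> (x - y) = eval2 \<phi> \<psi> x - eval2 \<phi> \<psi> y"
  by (metis add_diff_cancel_right' diff_add_cancel eval2_add)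

lemma eval2_fconst: "eval2 \<phi> \<psi> (fconst z * D) = z * eval2 \<phi> \<psi> D"
  by (induction D rule: falg_induct)
    (auto simp: eval2_add distrib_left mult_single fconst_def eval2_single mult.assoc)

lemma eval2_fgen: "eval2 \<phi> \<psi> ((fgen l \<otimes>\<^sub>f fgen r) * D) =
    eval2 (\<lambda>u. \<phi> (l # u)) (\<lambda>v. \<psi> (r # v)) D"
proof (induction D rule: falg_induct)
  case (single p z)
  show ?case
    by (cases p) (simp add: fgen_def ftensor_single mult_single eval2_single plus_list_def)
qed (auto simp: eval2_add distrib_left)

lemma SU_coprod_fgen_mult: "SU_coprod q (fgen g * x) = SU_coprod_gen q g * SU_coprod q x"
  by (simp add: SU_coprod_def fhom_mult fhom_fgen)

lemma SU_coprod_linear: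
  "SU_coprod q 0 = 0" "SU_coprod q 1 = 1"
  "SU_coprod q (x + y) = SU_coprod q x + SU_coprod q y"
  "SU_coprod q (x - y) = SU_coprod q x - SU_coprod q y"
  "SU_coprod q (fconst z * x) = fconst z * SU_coprod q x"
  "SU_coprod q (fconst z) = fconst z"
  by (simp_all add: SU_coprod_def fhom_add fhom_diff fhom_mult fhom_1 fhom_fconst)

lemma slice_one: "slice \<phi> 1 = fconst (\<phi> [])"
  using slice_single[of \<phi> "[]" "[]" 1] by (simp add: zero_prod_def zero_list_def single_Nil flip: single_one)

lemma eval2_one: "eval2 \<phi> \<psi> 1 = \<phi> [] * \<psi> []"
  using eval2_single[of \<phi> \<psi> "[]" "[]" 1] by (simp add: zero_prod_def zero_list_def flip: single_one)

abbreviation convolve :: "real \<Rightarrow> (agen list \<Rightarrow> complex) \<Rightarrow> (agen list \<Rightarrow> complex) \<Rightarrow> agen list \<Rightarrow> complex" where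
  "convolve q \<phi> \<psi> v \<equiv> eval2 \<phi> \<psi> (SU_coprod q (Poly_Mapping.single v 1))"

definition lact :: "real \<Rightarrow> (agen list \<Rightarrow> complex) \<Rightarrow> agen falg \<Rightarrow> agen falg" where
  "lact q \<phi> x = slice \<phi> (SU_coprod q x)"

lemma lact_linear:
  "lact q \<phi> 0 = 0" "lact q \<phi> (x + y) = lact q \<phi> x + lact q \<phi> y"
  "lact q \<phi> (x - y) = lact q \<phi> x - lact q \<phi> y"
  "lact q \<phi> (fconst z * x) = fconst z * lact q \<phi> x"
  "lact q \<phi> 1 = fconst (\<phi> [])" "lact q \<phi> (fconst z) = fconst (z * \<phi> [])"
  using slice_fconst[of \<phi> z 1]
  by (simp_all add: lact_def SU_coprod_linear slice_add slice_diff slice_fconst slice_one fconst_mult)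

lemma lact_fgen_mult:
  "lact q \<phi> (gen_a * x) = gen_a * lact q (\<lambda>v. \<phi> (Ga # v)) x - fconst q * (gen_cs * lact q (\<lambda>v. \<phi> (Gc # v)) x)"
  "lact q \<phi> (gen_c * x) = gen_c * lact q (\<lambda>v. \<phi> (Ga # v)) x + gen_as * lact q (\<lambda>v. \<phi> (Gc # v)) x"
  "lact q \<phi> (gen_as * x) = gen_as * lact q (\<lambda>v. \<phi> (Gas # v)) x - fconst q * (gen_c * lact q (\<lambda>v. \<phi> (Gcs # v)) x)"
  "lact q \<phi> (gen_cs * x) = gen_a * lact q (\<lambda>v. \<phi> (Gcs # v)) x + gen_cs * lact q (\<lambda>v. \<phi> (Gas # v)) x"
  by (simp_all add: lact_def SU_coprod_fgen_mult distrib_right left_diff_distrib slice_add slice_diff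
      mult.assoc slice_fconst slice_fgen)

lemma convolve_Cons:
  "convolve q \<phi> \<psi> (Ga # v) = convolve q (\<lambda>v. \<phi> (Ga # v)) (\<lambda>v. \<psi> (Ga # v)) v
     - q * convolve q (\<lambda>v. \<phi> (Gcs # v)) (\<lambda>v. \<psi> (Gc # v)) v"
  "convolve q \<phi> \<psi> (Gc # v) = convolve q (\<lambda>v. \<phi> (Gc # v)) (\<lambda>v. \<psi> (Ga # v)) v
     + convolve q (\<lambda>v. \<phi> (Gas # v)) (\<lambda>v. \<psi> (Gc # v)) v"
  "convolve q \<phi> \<psi> (Gas # v) = convolve q (\<lambda>v. \<phi> (Gas # v)) (\<lambda>v. \<psi> (Gas # v)) v
     - q * convolve q (\<lambda>v. \<phi> (Gc # v)) (\<lambda>v. \<psi> (Gcs # v)) v"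
  "convolve q \<phi> \<psi> (Gcs # v) = convolve q (\<lambda>v. \<phi> (Ga # v)) (\<lambda>v. \<psi> (Gcs # v)) v
     + convolve q (\<lambda>v. \<phi> (Gcs # v)) (\<lambda>v. \<psi> (Gas # v)) v"
  by (simp_all add: single_Cons SU_coprod_fgen_mult distrib_right left_diff_distrib eval2_add eval2_diff
      mult.assoc eval2_fconst eval2_fgen)

lemma lact_functional:
  "lact q (\<lambda>v. \<phi> v + \<psi> v) x = lact q \<phi> x + lact q \<psi> x"
  "lact q (\<lambda>v. \<phi> v - \<psi> v) x = lact q \<phi> x - lact q \<psi> x"
  "lact q (\<lambda>v. z * \<phi> v) x = fconst z * lact q \<phi> x"
  "lact q (\<lambda>v. 0) x = 0"
  by (simp_all add: lact_def slice_functional_add slice_functional_diff slice_functional_scale)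

text \<open>Coassociativity of the coproduct, tested against functionals in the last two legs.\<close>

lemma lact_convolve: "lact q (convolve q \<phi> \<psi>) x = lact q \<phi> (lact q \<psi> x)"
\<comment> \<open>Stripping a letter shifts both functionals, so both have to be general. The
  generator step compares the two ways of splitting the matrix coproduct.\<close>
proof (induction x arbitrary: \<phi> \<psi> rule: falg_word_induct)
  case one
  show ?case by (simp add: lact_linear single_Nil SU_coprod_linear eval2_one mult.commute)
next
  case (Cons g x)
  note IH = Cons.IH
  show ?case
    by (cases g) (simp_all add: lact_fgen_mult lact_linear convolve_Cons lact_functional IH
        algebra_simps mult_fconst_mult fconst_mult_fconst_mult)
qed (simp_all add: lact_linear)

lemma lact_counit: "lact q SU_counit x = x"
proof (induction x rule: falg_word_induct)
  case (Cons g x)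
  have c: "(\<lambda>v. SU_counit (g # v)) = (\<lambda>v. SU_counit_gen g * SU_counit v)" for g
    by (simp add: SU_counit_def)
  show ?case by (cases g) (simp_all add: lact_fgen_mult c lact_functional Cons)
qed (simp_all add: lact_linear, simp add: SU_counit_def)

section \<open>Words of the enveloping algebra as operators on the free algebra\<close>

abbreviation gact :: "real \<Rightarrow> ugen \<Rightarrow> agen falg \<Rightarrow> agen falg" where
  "gact q g \<equiv> lact q (pair_gen q g)"

lemma pair_word_Cons: "pair_word q (g # k) = convolve q (pair_gen q g) (pair_word q k)"
  by (simp add: fun_eq_iff eval2_def Let_def case_prod_beta)

lemma free_act_lact: "free_act q h = lact q (\<lambda>v. pairing q h (Poly_Mapping.single v 1))"
  by (simp add: fun_eq_iff free_act_def lact_def slice_def Let_def case_prod_beta)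

lemma pairing_word: "pairing q h (Poly_Mapping.single v 1) =
    (\<Sum>k\<in>Poly_Mapping.keys h. Poly_Mapping.lookup h k * pair_word q k v)"
  by (simp add: pairing_def)

lemma free_act_add: "free_act q (h + h') x = free_act q h x + free_act q h' x"
proof -
  have "pairing q (h + h') (Poly_Mapping.single v 1) =
      pairing q h (Poly_Mapping.single v 1) + pairing q h' (Poly_Mapping.single v 1)" for v
    unfolding pairing_word
    by (rule keys_sum_add[where h="\<lambda>k a. a * pair_word q k v"]) (simp_all add: algebra_simps)
  then show ?thesis by (simp add: free_act_lact lact_functional)
qed

lemma free_act_0 [simp]: "free_act q 0 x = 0"
  by (simp add: free_act_lact pairing_def lact_functional)

lemma free_act_single: "free_act q (Poly_Mapping.single k z) x = fconst z * lact q (pair_word q k) x"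
  by (simp add: free_act_lact pairing_word lact_functional)

lemma free_act_fconst: "free_act q (fconst z) x = fconst z * x"
proof -
  have "pair_word q [] = SU_counit" by (simp add: fun_eq_iff)
  then show ?thesis by (simp add: free_act_single lact_counit flip: single_Nil)
qed

lemma free_act_fconst_mult: "free_act q (fconst z * h) x = fconst z * free_act q h x"
  by (induction h rule: falg_induct)
    (auto simp: distrib_left free_act_add free_act_single fconst_mult_fconst_mult simp flip: single_eq_fconst_mult)

lemma free_act_fgen_mult: "free_act q (fgen g * h) x = gact q g (free_act q h x)"
  by (induction h rule: falg_induct)
    (auto simp: distrib_left free_act_add lact_linear free_act_single pair_word_Cons lact_convolve
      simp del: pair_word.simps simp flip: single_Cons)

lemma free_act_linear: "free_act q h 0 = 0" "free_act q h (x + y) = free_act q h x + free_act q h y"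
    "free_act q h (fconst z * x) = fconst z * free_act q h x"
    "free_act q h (x - y) = free_act q h x - free_act q h y"
  by (simp_all add: free_act_lact lact_linear)

text \<open>Coassociativity, in the form \<open>lact_convolve\<close>, turns products into
  compositions. The action of any \<open>ff q a b\<close> is thereby computed one generator at a
  time.\<close>

lemma free_act_mult: "free_act q (h * k) x = free_act q h (free_act q k x)"
proof (induction h rule: falg_word_induct)
  case one
  show ?case using free_act_fconst[of q 1] by simp
qed (simp_all add: distrib_right free_act_add free_act_linear mult.assoc free_act_fgen_mult
    free_act_fconst_mult)

lemma free_act_fgen: "free_act q (fgen g) x = gact q g x"
  using free_act_fgen_mult[of q g 1 x] free_act_fconst[of q 1] by simp

lemma free_act_diff: "free_act q (h - k) x = free_act q h x - free_act q k x"
  by (metis add_diff_cancel_right' diff_add_cancel free_act_add)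

section \<open>The ideal of relations\<close>

text \<open>Negatives come from multiplication by -1, so closure under sums and two-sided products
  suffices.\<close>

lemma ideal_ring_ofI:
  fixes J :: "'a::ring_1 set"
  assumes "0 \<in> J" "\<And>x y. x \<in> J \<Longrightarrow> y \<in> J \<Longrightarrow> x + y \<in> J"
    "\<And>x y. x \<in> J \<Longrightarrow> y * x \<in> J" "\<And>x y. x \<in> J \<Longrightarrow> x * y \<in> J"
  shows "ideal J ring_of"
proof (rule idealI[OF ring_ring_of])
  have "group (add_monoid (ring_of :: 'a ring))"
    using ring_ring_of abelian_group.a_group ring_def by blast
  moreover have "inv\<^bsub>add_monoid ring_of\<^esub> x = - 1 * x" for x :: 'a
    using group.inv_equality[OF calculation, of "- x" x] by (simp add: ring_of_def)
  moreover have "- x \<in> J" if "x \<in> J" for x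
    using assms(3)[OF that, of "- 1"] by simp
  ultimately show "subgroup J (add_monoid (ring_of :: 'a ring))"
    using assms by (intro group.subgroupI) (auto simp: ring_of_def)
qed (use assms in \<open>auto simp: ring_of_def\<close>)

lemma SU_ideal: "ideal (SU_ideal q) ring_of"
  unfolding SU_ideal_def by (rule ring.genideal_ideal[OF ring_ring_of]) (simp add: ring_of_def)

lemma SU_ideal_closed:
  shows "0 \<in> SU_ideal q" "x \<in> SU_ideal q \<Longrightarrow> y \<in> SU_ideal q \<Longrightarrow> x + y \<in> SU_ideal q"
    "x \<in> SU_ideal q \<Longrightarrow> y * x \<in> SU_ideal q" "x \<in> SU_ideal q \<Longrightarrow> x * y \<in> SU_ideal q"
  using additive_subgroup.zero_closed[OF ideal.axioms(1)[OF SU_ideal[of q]]]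
    additive_subgroup.a_closed[OF ideal.axioms(1)[OF SU_ideal[of q]]]
    ideal.I_l_closed[OF SU_ideal[of q]] ideal.I_r_closed[OF SU_ideal[of q]]
  by (auto simp: ring_of_def)

lemma SU_ideal_uminus: "x \<in> SU_ideal q \<Longrightarrow> - x \<in> SU_ideal q"
  using SU_ideal_closed(3)[of x q "- 1"] by simp

lemma SU_ideal_diff: "x \<in> SU_ideal q \<Longrightarrow> y \<in> SU_ideal q \<Longrightarrow> x - y \<in> SU_ideal q"
  using SU_ideal_closed(2) SU_ideal_uminus by (metis diff_conv_add_uminus)

lemma SU_ideal_sum: "(\<And>i. i \<in> S \<Longrightarrow> f i \<in> SU_ideal q) \<Longrightarrow> sum f S \<in> SU_ideal q"
  by (induction S rule: infinite_finite_induct) (auto simp: SU_ideal_closed)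

lemma SU_rels_in_ideal: "r \<in> SU_rels q \<Longrightarrow> r \<in> SU_ideal q" "r \<in> SU_rels q \<Longrightarrow> fstar r \<in> SU_ideal q"
  using ring.genideal_self[OF ring_ring_of, of "SU_rels q \<union> fstar ` SU_rels q"]
  by (auto simp: SU_ideal_def ring_of_def)

lemma SU_ideal_subset:
  assumes "ideal J ring_of" "SU_rels q \<subseteq> J" "fstar ` SU_rels q \<subseteq> J"
  shows "SU_ideal q \<subseteq> J"
  unfolding SU_ideal_def by (rule ring.genideal_minimal[OF ring_ring_of]) (use assms in auto)

lemma fstar_add: "fstar (x + y) = fstar x + fstar y"
  unfolding fstar_def
  by (rule keys_sum_add[where h="\<lambda>w a. Poly_Mapping.single (rev (map agen_star w)) (cnj a)"])
    (simp_all add: single_add)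

lemma fstar_single: "fstar (Poly_Mapping.single w z) = Poly_Mapping.single (rev (map agen_star w)) (cnj z)"
  by (simp add: fstar_def)

lemma fstar_0 [simp]: "fstar 0 = 0"
  by (simp add: fstar_def)

lemma fstar_diff: "fstar (x - y) = fstar x - fstar y"
  by (metis add_diff_cancel_right' diff_add_cancel fstar_add)

lemma fstar_mult: "fstar (x * y) = fstar y * fstar x"
proof (induction x rule: falg_induct)
  case (single k z)
  show ?case
    by (induction y rule: falg_induct)
      (simp_all add: fstar_add algebra_simps fstar_single mult_single plus_list_def)
qed (simp_all add: fstar_add algebra_simps)

lemma agen_star_agen_star [simp]: "agen_star (agen_star g) = g"
  by (cases g) auto

lemma fstar_fstar [simp]: "fstar (fstar x) = x"
  by (induction x rule: falg_induct) (simp_all add: fstar_add fstar_single rev_map o_def)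

lemma fstar_fconst: "fstar (fconst z) = fconst (cnj z)"
  by (simp add: fconst_def fstar_single zero_list_def)

lemma fstar_fgen: "fstar (fgen g) = fgen (agen_star g)"
  by (simp add: fgen_def fstar_single)

lemma fstar_1: "fstar 1 = 1"
  using fstar_fconst[of 1] by simp

text \<open>The preimage of the ideal under \<open>fstar\<close> is an ideal containing the
  relations and their adjoints, hence contains \<open>SU_ideal q\<close>; equality follows as
  \<open>fstar\<close> is an involution.\<close>

lemma fstar_SU_ideal: "fstar ` SU_ideal q = SU_ideal q"
proof -
  have "ideal {x. fstar x \<in> SU_ideal q} ring_of"
    by (rule ideal_ring_ofI) (auto simp: fstar_add fstar_mult SU_ideal_closed)
  then have "SU_ideal q \<subseteq> {x. fstar x \<in> SU_ideal q}"
    by (rule SU_ideal_subset) (auto simp: SU_rels_in_ideal)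
  then show ?thesis
    by (auto simp: image_iff) (metis fstar_fstar mem_Collect_eq subsetD)
qed

lemma fstar_SU_rels: "fstar ` SU_rels q = {
     gen_cs * gen_as - fconst q * (gen_as * gen_cs),
     gen_c * gen_as - fconst q * (gen_as * gen_c),
     gen_c * gen_cs - gen_cs * gen_c,
     gen_as * gen_a + gen_cs * gen_c - 1,
     gen_a * gen_as + fconst (q^2) * (gen_c * gen_cs) - 1}"
  by (simp add: SU_rels_def fstar_diff fstar_add fstar_mult fstar_fconst fstar_fgen fstar_1
      fconst_comm mult_fconst_mult mult.assoc)

lemma SU_rels_eq: "SU_rels q = {
     gen_a * gen_c - fconst q * (gen_c * gen_a),
     gen_a * gen_cs - fconst q * (gen_cs * gen_a),
     gen_c * gen_cs - gen_cs * gen_c,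
     gen_as * gen_a + gen_cs * gen_c - 1,
     gen_a * gen_as + fconst (q^2) * (gen_c * gen_cs) - 1}"
  by (simp add: SU_rels_def mult.assoc)

section \<open>Generators as twisted derivations, and stability of the ideal\<close>

lemma pair_gen_Cons: "(\<lambda>v. pair_gen q GK (x # v)) = (\<lambda>v. pair0 q GK x * pair_gen q GK v)"
  "(\<lambda>v. pair_gen q GKi (x # v)) = (\<lambda>v. pair0 q GKi x * pair_gen q GKi v)"
  "(\<lambda>v. pair_gen q GE (x # v)) = (\<lambda>v. pair0 q GE x * pair_gen q GK v + pair0 q GKi x * pair_gen q GE v)"
  "(\<lambda>v. pair_gen q GF (x # v)) = (\<lambda>v. pair0 q GF x * pair_gen q GK v + pair0 q GKi x * pair_gen q GF v)"
  by (simp_all add: fun_eq_iff)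

text \<open>Scalars are moved to the left past generators and actions, never past one
  another.\<close>

lemmas fconst_swap = mult_fconst_mult[of "fgen _"] mult_fconst_mult[of "lact _ _ _"]

text \<open>Here \<open>s\<close> is the square root of q. The factor q * (1/q) in the action of F
  is left uncancelled because q may be zero here.\<close>

lemma gact_fgen_mult:
  fixes q :: real
  defines "s \<equiv> complex_of_real (sqrt q)"
  shows
  "gact q GK (gen_a * x) = fconst (1 / s) * (gen_a * gact q GK x)"
  "gact q GK (gen_c * x) = fconst (1 / s) * (gen_c * gact q GK x)"
  "gact q GK (gen_as * x) = fconst s * (gen_as * gact q GK x)"
  "gact q GK (gen_cs * x) = fconst s * (gen_cs * gact q GK x)"
  "gact q GKi (gen_a * x) = fconst s * (gen_a * gact q GKi x)"
  "gact q GKi (gen_c * x) = fconst s * (gen_c * gact q GKi x)"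
  "gact q GKi (gen_as * x) = fconst (1 / s) * (gen_as * gact q GKi x)"
  "gact q GKi (gen_cs * x) = fconst (1 / s) * (gen_cs * gact q GKi x)"
  "gact q GE (gen_a * x) = fconst s * (gen_a * gact q GE x) - fconst q * (gen_cs * gact q GK x)"
  "gact q GE (gen_c * x) = fconst s * (gen_c * gact q GE x) + gen_as * gact q GK x"
  "gact q GE (gen_as * x) = fconst (1 / s) * (gen_as * gact q GE x)"
  "gact q GE (gen_cs * x) = fconst (1 / s) * (gen_cs * gact q GE x)"
  "gact q GF (gen_a * x) = fconst s * (gen_a * gact q GF x)"
  "gact q GF (gen_c * x) = fconst s * (gen_c * gact q GF x)"
  "gact q GF (gen_as * x) = fconst (1 / s) * (gen_as * gact q GF x) + fconst q * (fconst (1 / q) * (gen_c * gact q GK x))"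
  "gact q GF (gen_cs * x) = fconst (1 / s) * (gen_cs * gact q GF x) - fconst (1 / q) * (gen_a * gact q GK x)"
proof -
  have p: "pair0 q GK Ga = 1 / s" "pair0 q GK Gas = s" "pair0 q GKi Ga = s" "pair0 q GKi Gas = 1 / s"
    "pair0 q GE Gc = 1" "pair0 q GF Gcs = - (1 / q)" "pair0 q GK Gc = 0" "pair0 q GK Gcs = 0"
    "pair0 q GKi Gc = 0" "pair0 q GKi Gcs = 0" "pair0 q GE Ga = 0" "pair0 q GE Gas = 0" "pair0 q GE Gcs = 0"
    "pair0 q GF Ga = 0" "pair0 q GF Gas = 0" "pair0 q GF Gc = 0"
    by (simp_all add: s_def)
  note S = lact_fgen_mult pair_gen_Cons lact_functional p fconst_0 fconst_1 mult_zero_left mult_zero_right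
    mult_1_left diff_0_right add_0_left add_0_right fconst_uminus
    diff_minus_eq_add distrib_left fconst_swap of_real_minus of_real_divide of_real_1
    minus_diff_eq
  show "gact q GK (gen_a * x) = fconst (1 / s) * (gen_a * gact q GK x)"
    "gact q GK (gen_c * x) = fconst (1 / s) * (gen_c * gact q GK x)"
    "gact q GK (gen_as * x) = fconst s * (gen_as * gact q GK x)"
    "gact q GK (gen_cs * x) = fconst s * (gen_cs * gact q GK x)"
    "gact q GKi (gen_a * x) = fconst s * (gen_a * gact q GKi x)"
    "gact q GKi (gen_c * x) = fconst s * (gen_c * gact q GKi x)"
    "gact q GKi (gen_as * x) = fconst (1 / s) * (gen_as * gact q GKi x)"
    "gact q GKi (gen_cs * x) = fconst (1 / s) * (gen_cs * gact q GKi x)"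
    "gact q GE (gen_a * x) = fconst s * (gen_a * gact q GE x) - fconst q * (gen_cs * gact q GK x)"
    "gact q GE (gen_c * x) = fconst s * (gen_c * gact q GE x) + gen_as * gact q GK x"
    "gact q GE (gen_as * x) = fconst (1 / s) * (gen_as * gact q GE x)"
    "gact q GE (gen_cs * x) = fconst (1 / s) * (gen_cs * gact q GE x)"
    "gact q GF (gen_a * x) = fconst s * (gen_a * gact q GF x)"
    "gact q GF (gen_c * x) = fconst s * (gen_c * gact q GF x)"
    "gact q GF (gen_as * x) = fconst (1 / s) * (gen_as * gact q GF x) + fconst q * (fconst (1 / q) * (gen_c * gact q GK x))"
    "gact q GF (gen_cs * x) = fconst (1 / s) * (gen_cs * gact q GF x) - fconst (1 / q) * (gen_a * gact q GK x)"
    by (simp_all only: S) (simp_all add: algebra_simps fconst_swap)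
qed

text \<open>The left action touches only the column index of the matrix U, whose columns are formed
  by \<open>gen_a\<close>, \<open>gen_c\<close> and by -q \<open>gen_cs\<close>,
  \<open>gen_as\<close>. K scales the columns by inverse factors; E carries the first to the second
  and, for nonzero q, F carries the second to the first.\<close>

lemma gact_generators:
  fixes q :: real
  defines "s \<equiv> complex_of_real (sqrt q)"
  shows
  "gact q GK gen_a = fconst (1 / s) * gen_a" "gact q GK gen_c = fconst (1 / s) * gen_c"
  "gact q GK gen_as = fconst s * gen_as" "gact q GK gen_cs = fconst s * gen_cs"
  "gact q GKi gen_a = fconst s * gen_a" "gact q GKi gen_c = fconst s * gen_c"
  "gact q GKi gen_as = fconst (1 / s) * gen_as" "gact q GKi gen_cs = fconst (1 / s) * gen_cs"
  "gact q GE gen_a = - (fconst q * gen_cs)" "gact q GE gen_c = gen_as" "gact q GE gen_as = 0" "gact q GE gen_cs = 0"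
  "gact q GF gen_a = 0" "gact q GF gen_c = 0"
  "gact q GF gen_as = fconst q * (fconst (1 / q) * gen_c)" "gact q GF gen_cs = - (fconst (1 / q) * gen_a)"
  using gact_fgen_mult[of q 1] by (simp_all add: lact_linear s_def)

text \<open>These are the coproducts of K, E and F read as Leibniz rules. Multiplicativity of K is
  proved before the rules for E and F, whose induction steps use it.\<close>

lemma gact_mult:
  "gact q GK (x * y) = gact q GK x * gact q GK y"
  "gact q GKi (x * y) = gact q GKi x * gact q GKi y"
  "gact q GE (x * y) = gact q GE x * gact q GK y + gact q GKi x * gact q GE y"
  "gact q GF (x * y) = gact q GF x * gact q GK y + gact q GKi x * gact q GF y"
proof -
  note S = gact_fgen_mult mult.assoc distrib_left distrib_right left_diff_distrib right_diff_distrib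
     fconst_swap fconst_mult_fconst_mult lact_linear mult_ac[where 'a=complex]
  show K: "gact q GK (x * y) = gact q GK x * gact q GK y" for x y
  proof (induction x rule: falg_word_induct)
    case (Cons g x)
    then show ?case by (cases g) (simp_all only: S)
  qed (simp_all add: lact_linear algebra_simps)
  show Ki: "gact q GKi (x * y) = gact q GKi x * gact q GKi y" for x y
  proof (induction x rule: falg_word_induct)
    case (Cons g x)
    then show ?case by (cases g) (simp_all only: S)
  qed (simp_all add: lact_linear algebra_simps)
  show "gact q GE (x * y) = gact q GE x * gact q GK y + gact q GKi x * gact q GE y"
  proof (induction x rule: falg_word_induct)
    case (Cons g x)
    then show ?case by (cases g) (simp_all only: S K, simp_all only: algebra_simps)
  qed (simp_all add: lact_linear algebra_simps)
  show "gact q GF (x * y) = gact q GF x * gact q GK y + gact q GKi x * gact q GF y"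
  proof (induction x rule: falg_word_induct)
    case (Cons g x)
    then show ?case by (cases g) (simp_all only: S K, simp_all only: algebra_simps)
  qed (simp_all add: lact_linear algebra_simps)
qed

text \<open>Three of the five relations are self-adjoint, so seven elements are to be checked
  against four generators.\<close>

lemma gact_SU_rels:
  assumes "0 < q" "r \<in> SU_rels q \<union> fstar ` SU_rels q"
  shows "gact q g r \<in> SU_ideal q"
proof -
  \<comment> \<open>With q written as \<open>s * s\<close>, every coefficient is a monomial in
    \<open>s\<close> and its inverse \<open>t\<close>, and comparing coefficients is cancellation of
    \<open>s * t\<close>.\<close>
  define s t where "s = complex_of_real (sqrt q)" and "t = 1 / s"
  have s0: "s \<noteq> 0" and ss: "s * s = complex_of_real q"
    using assms(1) by (auto simp: s_def simp flip: of_real_mult)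
  have st: "s * t = 1" "t * s = 1" "s * (t * z) = z" "t * (s * z) = z" for z
    using s0 by (simp_all add: t_def)
  have qs: "complex_of_real q = s * s" "complex_of_real (1 / q) = t * t" "complex_of_real (q^2) = s * s * (s * s)"
    by (simp_all add: t_def power2_eq_square flip: ss)
  let ?J = "SU_ideal q"
  let ?r1 = "gen_a * gen_c - fconst q * (gen_c * gen_a)"
  let ?r2 = "gen_a * gen_cs - fconst q * (gen_cs * gen_a)"
  let ?r3 = "gen_c * gen_cs - gen_cs * gen_c"
  let ?r4 = "gen_as * gen_a + gen_cs * gen_c - 1"
  let ?r5 = "gen_a * gen_as + fconst (q^2) * (gen_c * gen_cs) - 1"
  let ?r6 = "gen_cs * gen_as - fconst q * (gen_as * gen_cs)"
  let ?r7 = "gen_c * gen_as - fconst q * (gen_as * gen_c)"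
  have J: "?r1 \<in> ?J" "?r2 \<in> ?J" "?r3 \<in> ?J" "?r4 \<in> ?J" "?r5 \<in> ?J" "?r6 \<in> ?J" "?r7 \<in> ?J"
  proof -
    have "SU_rels q \<subseteq> ?J" "fstar ` SU_rels q \<subseteq> ?J"
      using SU_rels_in_ideal by blast+
    then have "?r1 \<in> ?J \<and> ?r2 \<in> ?J \<and> ?r3 \<in> ?J \<and> ?r4 \<in> ?J \<and> ?r5 \<in> ?J" "?r6 \<in> ?J \<and> ?r7 \<in> ?J"
      by (simp_all only: fstar_SU_rels) (simp_all only: SU_rels_eq insert_subset)
    then show "?r1 \<in> ?J" "?r2 \<in> ?J" "?r3 \<in> ?J" "?r4 \<in> ?J" "?r5 \<in> ?J" "?r6 \<in> ?J" "?r7 \<in> ?J"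
      by (simp_all only: simp_thms)
  qed
  note C = SU_ideal_closed(1-3) SU_ideal_diff SU_ideal_uminus J
  note S = lact_linear gact_mult gact_generators[of q, folded s_def, folded t_def] fconst_swap fconst_mult_fconst_mult
    mult.assoc distrib_left distrib_right left_diff_distrib right_diff_distrib qs st fconst_1 mult_1_left mult_1_right
    mult_zero_left mult_zero_right minus_mult_left[symmetric] minus_mult_right[symmetric] fconst_comm[of "fgen _"]
    add_0_left add_0_right diff_0_right
  have u: "pair_gen q GK [] = 1" "pair_gen q GKi [] = 1" "pair_gen q GE [] = 0" "pair_gen q GF [] = 0"
    by simp_all
  have K: "gact q GK ?r1 = fconst (t * t) * ?r1" "gact q GK ?r2 = ?r2" "gact q GK ?r3 = ?r3"
     "gact q GK ?r4 = ?r4" "gact q GK ?r5 = ?r5" "gact q GK ?r6 = fconst (s * s) * ?r6" "gact q GK ?r7 = ?r7"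
    by (simp_all only: S u)
  have Ki: "gact q GKi ?r1 = fconst (s * s) * ?r1" "gact q GKi ?r2 = ?r2" "gact q GKi ?r3 = ?r3"
     "gact q GKi ?r4 = ?r4" "gact q GKi ?r5 = ?r5" "gact q GKi ?r6 = fconst (t * t) * ?r6" "gact q GKi ?r7 = ?r7"
    by (simp_all only: S u)
  \<comment> \<open>The relations span a representation: \<open>?r2\<close>, \<open>?r7\<close> and
    \<open>?r3 + ?r4\<close> are killed by E and F, while E leads from \<open>?r1\<close> through
    \<open>?r5 - ?r4\<close> to \<open>?r6\<close>, up to scalars, and F leads back.\<close>
  have E: "gact q GE ?r1 = fconst s * (?r5 - ?r4)" "gact q GE ?r2 = 0" "gact q GE ?r3 = - (fconst t * ?r6)"
     "gact q GE ?r4 = fconst t * ?r6" "gact q GE ?r5 = - (fconst (s * s * s) * ?r6)" "gact q GE ?r6 = 0" "gact q GE ?r7 = 0"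
    by (simp_all only: S u) (simp_all add: algebra_simps)
  have F: "gact q GF ?r1 = 0" "gact q GF ?r2 = 0" "gact q GF ?r3 = fconst (t * t * t) * ?r1"
     "gact q GF ?r4 = - (fconst (t * t * t) * ?r1)" "gact q GF ?r5 = fconst s * ?r1"
     "gact q GF ?r6 = fconst t * (?r4 - ?r5)" "gact q GF ?r7 = 0"
    by (simp_all only: S u) (simp_all add: algebra_simps)
  have "r \<in> {?r1, ?r2, ?r3, ?r4, ?r5, ?r6, ?r7}"
    using assms(2)[unfolded fstar_SU_rels, unfolded SU_rels_eq] by blast
  then show ?thesis
    by (cases g) (auto simp only: K Ki E F insert_iff empty_iff intro!: C)
qed

lemma gact_SU_ideal:
  assumes "0 < q" "x \<in> SU_ideal q"
  shows "gact q g x \<in> SU_ideal q"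
proof -
  \<comment> \<open>The Leibniz rules for E and F also involve K and its inverse, so stability under
    all four generators has to be carried along together.\<close>
  let ?J = "{x \<in> SU_ideal q. \<forall>g. gact q g x \<in> SU_ideal q}"
  have all: "(\<forall>g. P g) \<longleftrightarrow> P GK \<and> P GKi \<and> P GE \<and> P GF" for P
    by (metis ugen.exhaust)
  have "ideal ?J ring_of"
    by (rule ideal_ring_ofI) (auto simp: lact_linear all gact_mult SU_ideal_closed)
  then have "SU_ideal q \<subseteq> ?J"
    by (rule SU_ideal_subset) (use assms in \<open>auto simp: SU_rels_in_ideal gact_SU_rels\<close>)
  then show ?thesis using assms by blast
qed

lemma free_act_SU_ideal:
  assumes "0 < q" "x \<in> SU_ideal q"
  shows "free_act q h x \<in> SU_ideal q"
  using assms by (induction h rule: falg_word_induct)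
    (auto simp: free_act_add free_act_fconst_mult free_act_fgen_mult SU_ideal_closed gact_SU_ideal
      free_act_fconst[of q 1, simplified])

text \<open>The counit is a character sending both elements to z and all relations to 0. It is
  encoded with constants of the free algebra as values, so that \<open>fhom\<close> applies.\<close>

lemma fconst_in_SU_ideal: "fconst z \<in> SU_ideal q \<longleftrightarrow> z = 0"
  and fconst_mult_gen_a_in_SU_ideal: "fconst z * gen_a \<in> SU_ideal q \<longleftrightarrow> z = 0"
proof -
  let ?e = "fhom (\<lambda>g. fconst (SU_counit_gen g)) :: agen falg \<Rightarrow> agen falg"
  have "ideal {x. ?e x = 0} ring_of"
    by (rule ideal_ring_ofI) (auto simp: fhom_simps)
  then have "SU_ideal q \<subseteq> {x. ?e x = 0}"
  proof (rule SU_ideal_subset)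
    show "SU_rels q \<subseteq> {x. ?e x = 0}"
      unfolding SU_rels_eq by (simp add: fhom_simps)
    show "fstar ` SU_rels q \<subseteq> {x. ?e x = 0}"
      unfolding fstar_SU_rels by (simp add: fhom_simps)
  qed
  moreover have "?e (fconst z) = fconst z" "?e (fconst z * gen_a) = fconst z"
    by (simp_all add: fhom_simps)
  moreover have "fconst z = (0 :: agen falg) \<longleftrightarrow> z = 0"
    using fconst_inject[of z 0] by simp
  ultimately show "fconst z \<in> SU_ideal q \<longleftrightarrow> z = 0" "fconst z * gen_a \<in> SU_ideal q \<longleftrightarrow> z = 0"
    by (auto simp: SU_ideal_closed)
qed

section \<open>The quotient algebra\<close>

lemma ring_SU: "ring (SU q)"
  unfolding SU_def by (rule ideal.quotient_is_ring[OF SU_ideal])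

lemma cls_eq: "cls q x = (\<lambda>i. i + x) ` SU_ideal q"
  by (auto simp: cls_def a_r_coset_def' ring_of_def)

lemma cls_eq_iff: "cls q x = cls q y \<longleftrightarrow> x - y \<in> SU_ideal q"
proof
  assume "cls q x = cls q y"
  moreover have "x \<in> cls q x"
    using SU_ideal_closed(1) by (auto simp: cls_eq image_iff)
  ultimately show "x - y \<in> SU_ideal q"
    by (auto simp: cls_eq)
next
  have sub: "cls q x \<subseteq> cls q y" if "x - y \<in> SU_ideal q" for x y
  proof
    fix u assume "u \<in> cls q x"
    then obtain i where "i \<in> SU_ideal q" "u = i + x" by (auto simp: cls_eq)
    then have "u = (i + (x - y)) + y" "i + (x - y) \<in> SU_ideal q"
      using that SU_ideal_closed(2) by auto
    then show "u \<in> cls q y" unfolding cls_eq by blast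
  qed
  assume *: "x - y \<in> SU_ideal q"
  moreover have "y - x \<in> SU_ideal q"
    using SU_ideal_uminus[OF *] by simp
  ultimately show "cls q x = cls q y"
    using sub by blast
qed

lemma carrier_SU: "carrier (SU q) = range (cls q)"
  by (auto simp: SU_def FactRing_def A_RCOSETS_def' cls_def ring_of_def)

lemma cls_hom:
  "cls q x \<oplus>\<^bsub>SU q\<^esub> cls q y = cls q (x + y)" "cls q x \<otimes>\<^bsub>SU q\<^esub> cls q y = cls q (x * y)"
  "\<one>\<^bsub>SU q\<^esub> = scal q 1" "\<zero>\<^bsub>SU q\<^esub> = scal q 0"
proof -
  note h = ideal.rcos_ring_hom[OF SU_ideal[of q], folded SU_def]
  have c: "x \<in> carrier ring_of" for x :: "agen falg" by (simp add: ring_of_def)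
  show "cls q x \<oplus>\<^bsub>SU q\<^esub> cls q y = cls q (x + y)"
    using ring_hom_add[OF h c c, of x y] by (simp add: cls_def ring_of_def)
  show "cls q x \<otimes>\<^bsub>SU q\<^esub> cls q y = cls q (x * y)"
    using ring_hom_mult[OF h c c, of x y] by (simp add: cls_def ring_of_def)
  show "\<one>\<^bsub>SU q\<^esub> = scal q 1"
    using ring_hom_one[OF h] by (simp add: cls_def scal_def ring_of_def)
  show "\<zero>\<^bsub>SU q\<^esub> = scal q 0"
    by (simp add: SU_def FactRing_def scal_def cls_eq)
qed

lemma scal_inject: "scal q z = scal q w \<longleftrightarrow> z = w"
  by (simp add: scal_def cls_eq_iff fconst_in_SU_ideal flip: fconst_diff)

lemma cls_in_carrier [simp]: "cls q x \<in> carrier (SU q)" and scal_in_carrier [simp]: "scal q z \<in> carrier (SU q)"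
  by (simp_all add: carrier_SU scal_def)

lemma scal_hom: "scal q z \<oplus>\<^bsub>SU q\<^esub> scal q w = scal q (z + w)" "scal q z \<otimes>\<^bsub>SU q\<^esub> scal q w = scal q (z * w)"
  by (simp_all add: scal_def cls_hom fconst_add fconst_mult)

lemma finsum_cls:
  assumes "finite W"
  shows "(\<Oplus>\<^bsub>SU q\<^esub> i\<in>W. cls q (f i)) = cls q (sum f W)"
proof -
  interpret ring "SU q" by (rule ring_SU)
  show ?thesis
    using assms by (induction W) (simp_all add: cls_hom scal_def Pi_def)
qed

lemma finsum_scal:
  assumes "finite W"
  shows "(\<Oplus>\<^bsub>SU q\<^esub> i\<in>W. scal q (f i)) = scal q (sum f W)"
proof -
  have "fconst (sum f W) = (\<Sum>i\<in>W. fconst (f i) :: agen falg)"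
    using assms by (induction W) (simp_all add: fconst_add)
  then show ?thesis using finsum_cls[OF assms, of q "\<lambda>i. fconst (f i)"] by (simp add: scal_def)
qed

text \<open>All cosets in the union defining \<open>act\<close> coincide, since the action preserves
  the ideal.\<close>

lemma act_cls:
  assumes "0 < q"
  shows "act q h (cls q x) = cls q (free_act q h x)"
proof -
  have "cls q (free_act q h (i + x)) = cls q (free_act q h x)" if "i \<in> SU_ideal q" for i
    using free_act_SU_ideal[OF assms that] by (simp add: cls_eq_iff free_act_linear)
  then show ?thesis
    using SU_ideal_closed(1)[of q] unfolding act_def cls_eq[of q x] by auto
qed

lemma act_in_carrier:
  assumes "0 < q" "x \<in> carrier (SU q)"
  shows "act q h x \<in> carrier (SU q)"
  using assms by (auto simp: carrier_SU act_cls)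

lemma su_star_scal: "su_star (scal q z) = scal q (cnj z)"
proof -
  have "fstar ` cls q x = (\<lambda>i. i + fstar x) ` fstar ` SU_ideal q" for x
    by (simp add: cls_eq image_image fstar_add)
  then show ?thesis
    by (simp add: su_star_def scal_def fstar_fconst fstar_SU_ideal cls_eq)
qed

text \<open>K and its inverse fix constants, while E and F kill them. In the off-diagonal entry
  \<open>ff q Wz W0\<close> the contributions of \<open>Ki^2\<close> and \<open>KK^2\<close>
  cancel.\<close>

lemma act_ff_scal:
  assumes "0 < q"
  shows "act q (ff q a b) (scal q z) = scal q (if a = b then z else 0)"
proof -
  have g: "gact q GK (fconst z) = fconst z" "gact q GKi (fconst z) = fconst z"
    "gact q GE (fconst z) = 0" "gact q GF (fconst z) = 0" for z
    by (simp_all add: lact_linear)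
  have "free_act q (ff q a b) (fconst z) = fconst (if a = b then z else 0)"
    by (cases a; cases b)
      (simp_all add: free_act_mult free_act_add free_act_diff free_act_fgen free_act_fconst g
        power2_eq_square fconst_mult[symmetric] free_act_linear free_act_fconst[of q 1, simplified])
  then show ?thesis by (simp add: act_cls[OF assms] scal_def)
qed

section \<open>Forms with scalar coefficients\<close>

lemma finite_words [simp]: "finite (words k)"
  unfolding words_def using finite_lists_length_eq[of "UNIV :: ix set" k] by simp

lemma mem_words: "I \<in> words k \<longleftrightarrow> length I = k"
  by (simp add: words_def)

lemma sum_words_0: "(\<Sum>I\<in>words 0. F I) = F []"
  by (simp add: words_def)

lemma sum_words_Suc: "(\<Sum>I\<in>words (Suc k). F I) = (\<Sum>a\<in>UNIV. \<Sum>I\<in>words k. F (a # I))"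
proof -
  have "words (Suc k) = (\<lambda>(a, I). a # I) ` (UNIV \<times> words k)"
    by (auto simp: words_def length_Suc_conv image_iff)
  moreover have "inj_on (\<lambda>(a, I). a # I) (UNIV \<times> words k)"
    by (auto simp: inj_on_def)
  ultimately have "(\<Sum>I\<in>words (Suc k). F I) = (\<Sum>p\<in>UNIV \<times> words k. F (case p of (a, I) \<Rightarrow> a # I))"
    by (simp add: sum.reindex o_def)
  then show ?thesis
    by (simp add: sum.cartesian_product case_prod_beta)
qed

lemmas sum_words = sum_words_0 sum_words_Suc numeral_eq_Suc

lemma words_Suc_iff: "I \<in> words (Suc k) \<longleftrightarrow> (\<exists>a J. I = a # J \<and> J \<in> words k)"
  by (auto simp: words_def length_Suc_conv)

lemma words_0_iff: "I \<in> words 0 \<longleftrightarrow> I = []"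
  by (auto simp: words_def)

text \<open>On these forms scalars commute with all basis forms (\<open>move_scal\<close>), so
  tensor products and left-linear extensions of scalar matrices become complex matrix
  computations.\<close>

definition const_form :: "real \<Rightarrow> (ix list \<Rightarrow> complex) \<Rightarrow> form" where
  "const_form q c = (\<lambda>J. scal q (c J))"

lemma const_form_inject: "const_form q c = const_form q d \<longleftrightarrow> c = d"
  by (auto simp: const_form_def fun_eq_iff scal_inject)

lemma const_form_in_\<Omega>: "(\<And>I. I \<notin> words k \<Longrightarrow> c I = 0) \<Longrightarrow> const_form q c \<in> \<Omega> q k"
  by (auto simp: const_form_def \<Omega>_def cls_hom)

lemma \<omega>_const_form: "\<omega> q I = const_form q (\<lambda>J. of_bool (J = I))"
  by (simp add: \<omega>_def const_form_def cls_hom fun_eq_iff)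

lemma \<omega>_in_\<Omega>: "I \<in> words k \<Longrightarrow> \<omega> q I \<in> \<Omega> q k"
  unfolding \<omega>_const_form by (rule const_form_in_\<Omega>) auto

lemma move_scal:
  assumes "0 < q"
  shows "move q I J (scal q z) = scal q (if I = J then z else 0)"
proof (induction I arbitrary: J)
  case Nil
  show ?case by (cases J) (simp_all add: cls_hom)
next
  case (Cons a I)
  show ?case by (cases J) (auto simp: cls_hom Cons act_ff_scal[OF assms])
qed

lemma lmult_const_form: "lmult q (scal q z) (const_form q c) = const_form q (\<lambda>J. z * c J)"
  by (simp add: lmult_def const_form_def scal_hom)

lemma lin_ext_const_form:
  assumes "\<And>I. I \<in> words k \<Longrightarrow> T I = const_form q (t I)"
  shows "lin_ext q k T (const_form q c) = const_form q (\<lambda>J. \<Sum>I\<in>words k. c I * t I J)"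
proof
  interpret ring "SU q" by (rule ring_SU)
  fix J
  have "lin_ext q k T (const_form q c) J = (\<Oplus>\<^bsub>SU q\<^esub> I\<in>words k. scal q (c I * t I J))"
    unfolding lin_ext_def const_form_def
    by (intro finsum_cong') (auto simp: assms const_form_def scal_hom)
  then show "lin_ext q k T (const_form q c) J = const_form q (\<lambda>J. \<Sum>I\<in>words k. c I * t I J) J"
    by (simp add: finsum_scal const_form_def)
qed

lemma rmult_const_form:
  assumes "0 < q"
  shows "rmult q (const_form q c) (scal q z) = const_form q (\<lambda>J. c J * z)"
  by (simp add: rmult_def const_form_def move_scal[OF assms] scal_hom finsum_scal if_distrib[of "(*) _"]
      sum.delta' mem_words fun_eq_iff cong: if_cong)

text \<open>For a word shorter than k, \<open>take k J\<close> has the wrong length and matches no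
  index of the sum; this is the default value 0.\<close>

lemma tens_const_form:
  assumes "0 < q"
  shows "tens q k (const_form q c) (const_form q d) =
    const_form q (\<lambda>J. if k \<le> length J then c (take k J) * d (drop k J) else 0)"
  by (simp add: tens_def const_form_def move_scal[OF assms] scal_hom finsum_scal if_distrib[of "(*) _"]
      sum.delta' mem_words fun_eq_iff cong: if_cong)

lemma tens_\<omega>:
  assumes "0 < q"
  shows "tens q (length I) (\<omega> q I) (\<omega> q J) = \<omega> q (I @ J)"
proof -
  have "(if length I \<le> length K then of_bool (take (length I) K = I) * of_bool (drop (length I) K = J) else 0) =
      (of_bool (K = I @ J) :: complex)" for K
    by (auto simp: append_eq_conv_conj) (metis append_take_drop_id)
  then show ?thesis
    by (simp add: \<omega>_const_form tens_const_form[OF assms])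
qed

lemma form_star_\<omega>:
  assumes "0 < q"
  shows "form_star q (\<omega> q [a]) = const_form q (\<lambda>J. - of_bool (J = [bar a]))"
proof
  fix J
  have "su_star (\<omega> q [a] [b]) = scal q (of_bool (b = a))" for b
    by (simp add: \<omega>_const_form const_form_def su_star_scal)
  then have "form_star q (\<omega> q [a]) J =
      (\<Oplus>\<^bsub>SU q\<^esub> b\<in>UNIV. scal q (- 1 * of_bool (J = [bar b]) * of_bool (b = a)))"
    unfolding form_star_def
    by (simp only: \<omega>_const_form lmult_const_form rmult_const_form[OF assms]) (simp only: const_form_def)
  also have "\<dots> = scal q (- of_bool (J = [bar a]))"
    by (simp add: finsum_scal of_bool_def if_distrib[of "(*) _"] sum.delta cong: if_cong)
  finally show "form_star q (\<omega> q [a]) J = const_form q (\<lambda>J. - of_bool (J = [bar a])) J"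
    by (simp add: const_form_def)
qed

section \<open>The braiding\<close>

definition word_coeff :: "(complex \<times> ix list) list \<Rightarrow> ix list \<Rightarrow> complex" where
  "word_coeff ts J = (\<Sum>(z, K)\<leftarrow>ts. if K = J then z else 0)"

lemma word_coeff_simps [simp]: "word_coeff [] J = 0"
  "word_coeff ((z, K) # ts) J = (if K = J then z else 0) + word_coeff ts J"
  by (simp_all add: word_coeff_def)

definition braid :: "real \<Rightarrow> ix list \<Rightarrow> ix list \<Rightarrow> complex" where
  "braid q I = word_coeff (sigma_terms q (I ! 0) (I ! 1))"

text \<open>The inverse of the braiding, which splits into blocks of fixed U(1)-weight. For instance
  the images of -0 and 0- are solved for 0- and -0.\<close>

fun sigma_inv_terms :: "real \<Rightarrow> ix \<Rightarrow> ix \<Rightarrow> (complex \<times> ix list) list" where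
  "sigma_inv_terms q Wm Wm = [(1, [Wm, Wm])]"
| "sigma_inv_terms q Wp Wp = [(1, [Wp, Wp])]"
| "sigma_inv_terms q W0 W0 = [(1, [W0, W0])]"
| "sigma_inv_terms q Wm W0 = [(1 / q^2, [W0, Wm])]"
| "sigma_inv_terms q W0 Wm = [(1, [Wm, W0]), (1 - 1 / q^2, [W0, Wm])]"
| "sigma_inv_terms q Wz Wm = [(1, [Wm, Wz]), (- (1 + 1 / q^2), [W0, Wm])]"
| "sigma_inv_terms q Wm Wz = [(q^2, [Wz, Wm]), (1 - q^2, [Wm, Wz]), (1 + q^2, [W0, Wm])]"
| "sigma_inv_terms q Wp W0 = [(q^2, [W0, Wp])]"
| "sigma_inv_terms q W0 Wp = [(1, [Wp, W0]), (1 - q^2, [W0, Wp])]"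
| "sigma_inv_terms q Wz Wp = [(1, [Wp, Wz]), (1 + q^2, [W0, Wp])]"
| "sigma_inv_terms q Wp Wz = [(1 / q^2, [Wz, Wp]), (1 - 1 / q^2, [Wp, Wz]), (- (1 + 1 / q^2), [W0, Wp])]"
| "sigma_inv_terms q Wz W0 = [(1, [W0, Wz])]"
| "sigma_inv_terms q Wp Wm = [(1, [Wm, Wp]), (1, [W0, Wz])]"
| "sigma_inv_terms q Wm Wp = [(1, [Wp, Wm]), (- 1, [W0, Wz])]"
| "sigma_inv_terms q W0 Wz = [(1, [Wz, W0]),
     ((q - 1 / q)^2, [Wp, Wm]), (- ((q - 1 / q)^2), [Wm, Wp]), (- ((q - 1 / q)^2), [W0, Wz])]"
| "sigma_inv_terms q Wz Wz = [(1, [Wz, Wz]),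
     (- (q^2 - 1 / q^2), [Wp, Wm]), (q^2 - 1 / q^2, [Wm, Wp]), (q^2 - 1 / q^2, [W0, Wz])]"

definition braid_inv :: "real \<Rightarrow> ix list \<Rightarrow> ix list \<Rightarrow> complex" where
  "braid_inv q I = word_coeff (sigma_inv_terms q (I ! 0) (I ! 1))"

lemma sum_word_coeff:
  assumes "\<And>z K. (z, K) \<in> set ts \<Longrightarrow> K \<in> words k"
  shows "(\<Sum>J\<in>words k. word_coeff ts J * u J) = (\<Sum>(z, K)\<leftarrow>ts. z * u K)"
  using assms
proof (induction ts)
  case (Cons t ts)
  obtain z K where t: "t = (z, K)" by (cases t)
  have "K \<in> words k" using Cons.prems t by auto
  then have "(\<Sum>J\<in>words k. (if K = J then z else 0) * u J) = z * u K"
    by (simp add: if_distrib[of "\<lambda>x. x * _"] sum.delta cong: if_cong)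
  then show ?case using Cons t by (auto simp: distrib_right sum.distrib)
qed simp

lemma sigma_terms_words: "(z, K) \<in> set (sigma_terms q a b) \<Longrightarrow> K \<in> words 2"
  by (cases a; cases b) (auto simp: mem_words)

lemma word_coeff_nonzero: "word_coeff ts J \<noteq> 0 \<Longrightarrow> \<exists>z. (z, J) \<in> set ts"
  by (induction ts) (auto split: if_splits)

lemma braid_outside: "J \<notin> words 2 \<Longrightarrow> braid q I J = 0"
  unfolding braid_def using word_coeff_nonzero sigma_terms_words by metis

lemma words_2: "I \<in> words 2 \<longleftrightarrow> (\<exists>a b. I = [a, b])"
  by (auto simp: words_Suc_iff words_0_iff numeral_eq_Suc)

lemma words_3: "I \<in> words 3 \<longleftrightarrow> (\<exists>a b c. I = [a, b, c])"
  by (auto simp: words_Suc_iff words_0_iff numeral_eq_Suc)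

lemma sum_words_2: "(\<Sum>I\<in>words 2. F I) = (\<Sum>a\<in>UNIV. \<Sum>b\<in>UNIV. F [a, b])"
  and sum_words_3: "(\<Sum>I\<in>words 3. F I) = (\<Sum>a\<in>UNIV. \<Sum>b\<in>UNIV. \<Sum>c\<in>UNIV. F [a, b, c])"
  by (simp_all add: sum_words)

text \<open>The sum is the coefficient of the word L after applying the braiding and then its
  inverse to the basis element I. Summing over the listed terms of the braiding leaves at most four
  summands in each of the 256 cases.\<close>

lemma braid_braid_inv:
  assumes "0 < q" "I \<in> words 2" "L \<in> words 2"
  shows "(\<Sum>J\<in>words 2. braid q I J * braid_inv q J L) = of_bool (I = L)"
proof -
  obtain a b c d where I: "I = [a, b]" and L: "L = [c, d]"
    using assms by (auto simp: words_2)
  have q: "complex_of_real q \<noteq> 0" using assms by simp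
  have "(\<Sum>J\<in>words 2. braid q I J * braid_inv q J L) =
      (\<Sum>(z, K)\<leftarrow>sigma_terms q a b. z * braid_inv q K L)"
    unfolding braid_def I by (simp add: sum_word_coeff[OF sigma_terms_words])
  also have "\<dots> = of_bool (I = L)"
    unfolding I L braid_inv_def using q
    by (cases a; cases b; cases c; cases d; simp; simp add: field_simps power2_eq_square)
  finally show ?thesis .
qed

lemma sigma_const_form: "\<sigma> q (const_form q c) = const_form q (\<lambda>J. \<Sum>I\<in>words 2. c I * braid q I J)"
  unfolding \<sigma>_def
  by (rule lin_ext_const_form) (simp add: sigma_basis_def const_form_def braid_def word_coeff_def)

lemma sigma_\<omega>: "I \<in> words 2 \<Longrightarrow> \<sigma> q (\<omega> q I) = const_form q (braid q I)"
  by (simp add: \<omega>_const_form sigma_const_form sum.delta of_bool_def if_distrib[of "\<lambda>x. x * _"] cong: if_cong)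

text \<open>The scalar matrix of the braiding on the first two legs, in the shape produced by
  \<open>tens_const_form\<close>, which is the source of the length guard.\<close>

definition braid1 :: "real \<Rightarrow> ix list \<Rightarrow> ix list \<Rightarrow> complex" where
  "braid1 q I J = (if 2 \<le> length J then braid q (take 2 I) (take 2 J) * of_bool (drop 2 J = drop 2 I) else 0)"

definition braid2 :: "real \<Rightarrow> ix list \<Rightarrow> ix list \<Rightarrow> complex" where
  "braid2 q I J = (if 1 \<le> length J then of_bool (take 1 J = take 1 I) * braid q (drop 1 I) (drop 1 J) else 0)"

lemma braid1_outside:
  assumes "I \<in> words 3" "J \<notin> words 3"
  shows "braid1 q I J = 0"
proof -
  have "drop 2 J \<noteq> drop 2 I" if "2 \<le> length J"
  proof
    assume "drop 2 J = drop 2 I"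
    from arg_cong[OF this, of length] show False
      using assms that by (simp add: mem_words)
  qed
  then show ?thesis by (simp add: braid1_def)
qed

lemma sigma1_basis:
  assumes "0 < q" "I \<in> words 3"
  shows "tens q 2 (\<sigma> q (\<omega> q (take 2 I))) (\<omega> q (drop 2 I)) = const_form q (braid1 q I)"
proof -
  have "take 2 I \<in> words 2" using assms by (simp add: mem_words)
  then have "tens q 2 (\<sigma> q (\<omega> q (take 2 I))) (\<omega> q (drop 2 I)) =
      tens q 2 (const_form q (braid q (take 2 I))) (const_form q (\<lambda>J. of_bool (J = drop 2 I)))"
    by (simp only: sigma_\<omega>) (simp only: \<omega>_const_form)
  then show ?thesis by (simp add: tens_const_form[OF assms(1)] braid1_def[abs_def])
qed

lemma sigma2_basis:
  assumes "0 < q" "I \<in> words 3"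
  shows "tens q 1 (\<omega> q (take 1 I)) (\<sigma> q (\<omega> q (drop 1 I))) = const_form q (braid2 q I)"
proof -
  have "drop 1 I \<in> words 2" using assms by (simp add: mem_words)
  then have "tens q 1 (\<omega> q (take 1 I)) (\<sigma> q (\<omega> q (drop 1 I))) =
      tens q 1 (const_form q (\<lambda>J. of_bool (J = take 1 I))) (const_form q (braid q (drop 1 I)))"
    by (simp only: sigma_\<omega>) (simp only: \<omega>_const_form)
  then show ?thesis unfolding tens_const_form[OF assms(1)] braid2_def[abs_def] .
qed

lemma sigma1_const_form:
  "0 < q \<Longrightarrow> \<sigma>1 q (const_form q c) = const_form q (\<lambda>J. \<Sum>I\<in>words 3. c I * braid1 q I J)"
  unfolding \<sigma>1_def by (rule lin_ext_const_form) (rule sigma1_basis)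

lemma sigma2_const_form:
  "0 < q \<Longrightarrow> \<sigma>2 q (const_form q c) = const_form q (\<lambda>J. \<Sum>I\<in>words 3. c I * braid2 q I J)"
  unfolding \<sigma>2_def by (rule lin_ext_const_form) (rule sigma2_basis)

text \<open>The coefficients of the forms are arbitrary elements of the algebra, only the matrix is
  scalar. Since constants are central, applying \<open>u\<close> recovers the coefficients.\<close>

lemma lin_ext_inj_on:
  assumes T: "\<And>I. I \<in> words k \<Longrightarrow> T I = const_form q (t I)"
    and inv: "\<And>I K. I \<in> words k \<Longrightarrow> K \<in> words k \<Longrightarrow> (\<Sum>J\<in>words k. t I J * u J K) = of_bool (I = K)"
  shows "inj_on (lin_ext q k T) (\<Omega> q k)"
proof (rule inj_onI)
  interpret ring "SU q" by (rule ring_SU)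
  have rep: "\<exists>f. \<Phi> = (\<lambda>J. cls q (f J))" if "\<Phi> \<in> \<Omega> q k" for \<Phi>
  proof -
    have "\<exists>x. \<Phi> J = cls q x" for J
      using that by (cases "J \<in> words k") (auto simp: \<Omega>_def carrier_SU cls_hom scal_def image_iff)
    then show ?thesis by metis
  qed
  have ext: "lin_ext q k T (\<lambda>J. cls q (f J)) J = cls q (\<Sum>I\<in>words k. fconst (t I J) * f I)" for f J
  proof -
    have "lin_ext q k T (\<lambda>J. cls q (f J)) J = (\<Oplus>\<^bsub>SU q\<^esub> I\<in>words k. cls q (fconst (t I J) * f I))"
      unfolding lin_ext_def
      by (intro finsum_cong') (auto simp: T const_form_def scal_def cls_hom fconst_comm)
    then show ?thesis by (simp add: finsum_cls)
  qed
  fix \<Phi> \<Psi> assume \<Phi>: "\<Phi> \<in> \<Omega> q k" and \<Psi>: "\<Psi> \<in> \<Omega> q k" and eq: "lin_ext q k T \<Phi> = lin_ext q k T \<Psi>"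
  obtain f g where f: "\<Phi> = (\<lambda>J. cls q (f J))" and g: "\<Psi> = (\<lambda>J. cls q (g J))"
    using rep[OF \<Phi>] rep[OF \<Psi>] by blast
  let ?d = "\<lambda>I. f I - g I"
  have "cls q (\<Sum>I\<in>words k. fconst (t I J) * f I) = cls q (\<Sum>I\<in>words k. fconst (t I J) * g I)" for J
    using fun_cong[OF eq, of J] unfolding f g ext .
  then have mem: "(\<Sum>I\<in>words k. fconst (t I J) * ?d I) \<in> SU_ideal q" for J
    by (simp add: cls_eq_iff right_diff_distrib sum_subtractf)
  have "\<Phi> K = \<Psi> K" for K
  proof (cases "K \<in> words k")
    case True
    have fsum: "fconst (sum F S) = (\<Sum>i\<in>S. fconst (F i) :: agen falg)" for F and S :: "ix list set"
      by (induction S rule: infinite_finite_induct) (simp_all add: fconst_add)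
    \<comment> \<open>Applying \<open>u\<close> to combinations known to lie in the ideal returns
      the difference of the two representatives at \<open>K\<close>, which therefore lies in it
      too.\<close>
    have "(\<Sum>J\<in>words k. fconst (u J K) * (\<Sum>I\<in>words k. fconst (t I J) * ?d I)) =
        (\<Sum>I\<in>words k. \<Sum>J\<in>words k. fconst (t I J * u J K) * ?d I)"
      by (subst sum.swap) (simp add: sum_distrib_left fconst_mult_fconst_mult mult.commute)
    also have "\<dots> = (\<Sum>I\<in>words k. fconst (\<Sum>J\<in>words k. t I J * u J K) * ?d I)"
      by (simp add: fsum sum_distrib_right)
    also have "\<dots> = (\<Sum>I\<in>words k. fconst (of_bool (I = K)) * ?d I)"
      using inv True by simp
    also have "\<dots> = (\<Sum>I\<in>words k. if I = K then ?d I else 0)"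
      by (intro sum.cong) auto
    also have "\<dots> = ?d K"
      using True by (simp add: sum.delta')
    finally have "?d K = (\<Sum>J\<in>words k. fconst (u J K) * (\<Sum>I\<in>words k. fconst (t I J) * ?d I))" ..
    also have "\<dots> \<in> SU_ideal q"
      by (intro SU_ideal_sum SU_ideal_closed(3) mem)
    finally show ?thesis by (simp add: f g cls_eq_iff)
  next
    case False
    then show ?thesis using \<Phi> \<Psi> by (auto simp: \<Omega>_def)
  qed
  then show "\<Phi> = \<Psi>" by blast
qed

text \<open>The inverse matrix is that of the inverse braiding on the first two letters, with the
  third letter fixed.\<close>

lemma sigma1_inj_on:
  assumes "0 < q"
  shows "inj_on (\<sigma>1 q) (\<Omega> q 3)"
  unfolding \<sigma>1_def
proof (rule lin_ext_inj_on[where t="braid1 q" and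
      u="\<lambda>J K. braid_inv q (take 2 J) (take 2 K) * of_bool (drop 2 J = drop 2 K)"])
  fix I K :: "ix list" assume "I \<in> words 3" "K \<in> words 3"
  then obtain a b c d e f where I: "I = [a, b, c]" and K: "K = [d, e, f]"
    by (auto simp: words_3)
  have "(\<Sum>J\<in>words 3. braid1 q I J * (braid_inv q (take 2 J) (take 2 K) * of_bool (drop 2 J = drop 2 K)))
      = (\<Sum>x\<in>UNIV. \<Sum>y\<in>UNIV. \<Sum>z\<in>UNIV. if z = c then
          braid q [a, b] [x, y] * braid_inv q [x, y] [d, e] * of_bool (c = f) else 0)"
    unfolding sum_words_3 I K by (intro sum.cong) (auto simp: braid1_def)
  also have "\<dots> = (\<Sum>J\<in>words 2. braid q [a, b] J * braid_inv q J [d, e]) * of_bool (c = f)"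
    by (simp add: sum.delta sum_words_2 sum_distrib_right)
  also have "\<dots> = of_bool (I = K)"
    using braid_braid_inv[OF assms, of "[a, b]" "[d, e]"] by (auto simp: words_2 I K)
  finally show "(\<Sum>J\<in>words 3. braid1 q I J *
      (braid_inv q (take 2 J) (take 2 K) * of_bool (drop 2 J = drop 2 K))) = of_bool (I = K)" .
qed (rule sigma1_basis[OF assms])

section \<open>Metrics with constant coefficients\<close>

text \<open>Left linearity over a basis, obtained by enlarging the set of words on which the form is
  supported.\<close>

lemma bimodule_hom_expand:
  assumes g: "bimodule_hom q g" and \<Phi>: "\<Phi> \<in> \<Omega> q 2"
  shows "g \<Phi> = (\<Oplus>\<^bsub>SU q\<^esub> I\<in>words 2. \<Phi> I \<otimes>\<^bsub>SU q\<^esub> g (\<omega> q I))"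
proof -
  interpret ring "SU q" by (rule ring_SU)
  have add: "g (form_add q \<Phi> \<Psi>) = g \<Phi> \<oplus>\<^bsub>SU q\<^esub> g \<Psi>" if "\<Phi> \<in> \<Omega> q 2" "\<Psi> \<in> \<Omega> q 2" for \<Phi> \<Psi>
    using g that by (auto simp: bimodule_hom_def)
  have lmult: "g (lmult q x \<Phi>) = x \<otimes>\<^bsub>SU q\<^esub> g \<Phi>" if "x \<in> carrier (SU q)" "\<Phi> \<in> \<Omega> q 2" for x \<Phi>
    using g that by (auto simp: bimodule_hom_def)
  have carrier: "g \<Phi> \<in> carrier (SU q)" if "\<Phi> \<in> \<Omega> q 2" for \<Phi>
    using g that by (auto simp: bimodule_hom_def)
  have \<Phi>_carrier: "\<Phi> I \<in> carrier (SU q)" for I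
    using \<Phi> by (cases "I \<in> words 2") (auto simp: \<Omega>_def)
  let ?cut = "\<lambda>W. (\<lambda>J. if J \<in> W then \<Phi> J else \<zero>\<^bsub>SU q\<^esub>)"
  have cut: "g (?cut W) = (\<Oplus>\<^bsub>SU q\<^esub> I\<in>W. \<Phi> I \<otimes>\<^bsub>SU q\<^esub> g (\<omega> q I))" if "finite W" "W \<subseteq> words 2" for W
    using that
  proof (induction W)
    case empty
    \<comment> \<open>Writing the zero form as 0 times \<open>\<Phi>\<close> lets left linearity
      determine its image.\<close>
    have "?cut {} = lmult q \<zero>\<^bsub>SU q\<^esub> \<Phi>"
      using \<Phi>_carrier by (auto simp: lmult_def fun_eq_iff)
    then show ?case
      using lmult[OF zero_closed \<Phi>] carrier[OF \<Phi>] by simp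
  next
    case (insert I W)
    have I: "\<omega> q I \<in> \<Omega> q 2"
      by (rule \<omega>_in_\<Omega>) (use insert.prems in simp)
    have W: "?cut W \<in> \<Omega> q 2"
      using insert.prems \<Phi>_carrier by (auto simp: \<Omega>_def)
    have "?cut (insert I W) = form_add q (lmult q (\<Phi> I) (\<omega> q I)) (?cut W)"
      using insert.hyps \<Phi>_carrier by (auto simp: form_add_def lmult_def \<omega>_def fun_eq_iff)
    moreover have "lmult q (\<Phi> I) (\<omega> q I) \<in> \<Omega> q 2"
      using insert.prems \<Phi>_carrier by (auto simp: lmult_def \<omega>_def \<Omega>_def)
    ultimately have "g (?cut (insert I W)) = \<Phi> I \<otimes>\<^bsub>SU q\<^esub> g (\<omega> q I) \<oplus>\<^bsub>SU q\<^esub> g (?cut W)"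
      using add W lmult[OF \<Phi>_carrier I] by simp
    moreover have "(\<lambda>I. \<Phi> I \<otimes>\<^bsub>SU q\<^esub> g (\<omega> q I)) \<in> insert I W \<rightarrow> carrier (SU q)"
      using insert.prems \<Phi>_carrier carrier \<omega>_in_\<Omega> by auto
    ultimately show ?case
      using insert by auto
  qed
  have "?cut (words 2) = \<Phi>"
    using \<Phi> by (intro ext) (simp add: \<Omega>_def)
  with cut[OF finite_words order_refl] show ?thesis by (simp only:)
qed

lemma move_in_carrier:
  assumes "0 < q" "x \<in> carrier (SU q)"
  shows "move q I J x \<in> carrier (SU q)"
proof (induction I arbitrary: J)
  case Nil
  then show ?case using assms by (cases J) (simp_all add: cls_hom)
next
  case (Cons a I)
  then show ?case by (cases J) (simp_all add: act_in_carrier[OF assms(1)] cls_hom)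
qed

lemma tens_in_\<Omega>:
  assumes "0 < q" "\<phi> \<in> \<Omega> q 1" "\<psi> \<in> \<Omega> q 1"
  shows "tens q 1 \<phi> \<psi> \<in> \<Omega> q 2"
proof -
  interpret ring "SU q" by (rule ring_SU)
  have \<phi>: "\<phi> I \<in> carrier (SU q)" and \<psi>: "\<psi> I \<in> carrier (SU q)" for I
    using assms by (cases "I \<in> words 1"; auto simp: \<Omega>_def)+
  show ?thesis
    unfolding \<Omega>_def mem_Collect_eq
  proof (intro conjI ballI allI impI)
    fix J show "tens q 1 \<phi> \<psi> J \<in> carrier (SU q)"
      unfolding tens_def by (rule finsum_closed) (use \<phi> \<psi> move_in_carrier[OF assms(1)] in auto)
  next
    fix J :: "ix list" assume J: "J \<notin> words 2"
    \<comment> \<open>The empty word has no first letter for \<open>move\<close> to match; for any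
      other word of the wrong length the tail is not a single letter, and \<open>\<psi>\<close>
      vanishes there.\<close>
    have "\<phi> I \<otimes>\<^bsub>SU q\<^esub> move q I (take 1 J) (\<psi> (drop 1 J)) = \<zero>\<^bsub>SU q\<^esub>" if I: "I \<in> words 1" for I
    proof (cases "J = []")
      case True
      then show ?thesis
        using I \<phi> by (cases I) (auto simp: words_def)
    next
      case False
      then have "drop 1 J \<notin> words 1"
        using J by (cases J) (auto simp: words_def)
      then have "\<psi> (drop 1 J) = scal q 0"
        using assms(3) by (auto simp: \<Omega>_def cls_hom)
      then show ?thesis
        using \<phi> by (simp add: move_scal[OF assms(1)]) (simp flip: cls_hom)
    qed
    then show "tens q 1 \<phi> \<psi> J = \<zero>\<^bsub>SU q\<^esub>"
      unfolding tens_def by (intro add.finprod_one_eqI) auto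
  qed
qed

text \<open>The matrix \<open>G\<close> holds the values on basis forms; nondegeneracy, reality and
  the braiding conditions enter as premises of individual lemmas.\<close>

locale constant_metric =
  fixes q :: real and g :: metric and G :: "ix \<Rightarrow> ix \<Rightarrow> complex"
  assumes q: "0 < q" "q < 1"
    and hom: "bimodule_hom q g"
    and G: "\<And>a b. g (\<omega> q [a, b]) = scal q (G a b)"
begin

lemma metric_const_form:
  assumes "const_form q c \<in> \<Omega> q 2"
  shows "g (const_form q c) = scal q (\<Sum>a\<in>UNIV. \<Sum>b\<in>UNIV. c [a, b] * G a b)"
proof -
  interpret ring "SU q" by (rule ring_SU)
  have "g (const_form q c) = (\<Oplus>\<^bsub>SU q\<^esub> I\<in>words 2. scal q (c I * G (I ! 0) (I ! 1)))"
    unfolding bimodule_hom_expand[OF hom assms]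
    by (intro finsum_cong') (auto simp: words_2 const_form_def G scal_hom)
  then show ?thesis by (simp add: finsum_scal sum_words_2)
qed

lemma metric_id_const_form:
  "metric_id q g (const_form q c) = const_form q (\<lambda>J. \<Sum>I\<in>words 3. c I * (G (I ! 0) (I ! 1) * of_bool (J = drop 2 I)))"
  unfolding metric_id_def
  by (rule lin_ext_const_form) (auto simp: words_3 G \<omega>_const_form[of q "[_]"] lmult_const_form)

lemma id_metric_const_form:
  "id_metric q g (const_form q c) = const_form q (\<lambda>J. \<Sum>I\<in>words 3. c I * (of_bool (J = take 1 I) * G (I ! 1) (I ! 2)))"
  unfolding id_metric_def
  by (rule lin_ext_const_form) (auto simp: words_3 G \<omega>_const_form[of q "[_]"] rmult_const_form[OF q(1)])

lemma metric_tens_\<omega>: "g (tens q 1 (\<omega> q [a]) (\<omega> q [b])) = scal q (G a b)"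
  using tens_\<omega>[OF q(1), of "[a]" "[b]"] by (simp add: G)

lemma inv_emb_const_form: "inv_emb q u = const_form q (\<lambda>J. case J of [a] \<Rightarrow> u a | _ \<Rightarrow> 0)"
  by (auto simp: inv_emb_def const_form_def cls_hom fun_eq_iff split: list.splits)

lemma metric_inv_emb:
  "g (tens q 1 (inv_emb q u) (inv_emb q v)) = scal q (\<Sum>a\<in>UNIV. \<Sum>b\<in>UNIV. u a * v b * G a b)"
proof -
  have in1: "inv_emb q u \<in> \<Omega> q 1" for u
    unfolding inv_emb_const_form by (rule const_form_in_\<Omega>) (auto simp: mem_words split: list.splits)
  have "tens q 1 (inv_emb q u) (inv_emb q v) \<in> \<Omega> q 2"
    by (rule tens_in_\<Omega>[OF q(1) in1 in1])
  then show ?thesis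
    unfolding inv_emb_const_form tens_const_form[OF q(1)]
    by (subst metric_const_form) simp_all
qed

section \<open>Linear equations for the coefficients\<close>

lemma braid_invariance:
  assumes "\<forall>\<Phi>\<in>\<Omega> q 2. g (\<sigma> q \<Phi>) = g \<Phi>"
  shows "(\<Sum>x\<in>UNIV. \<Sum>y\<in>UNIV. braid q [a, b] [x, y] * G x y) = G a b"
proof -
  have w: "[a, b] \<in> words 2" by (simp add: mem_words)
  have "const_form q (braid q [a, b]) \<in> \<Omega> q 2"
    by (rule const_form_in_\<Omega>) (rule braid_outside)
  from metric_const_form[OF this]
  have "g (\<sigma> q (\<omega> q [a, b])) = scal q (\<Sum>x\<in>UNIV. \<Sum>y\<in>UNIV. braid q [a, b] [x, y] * G x y)"
    by (simp add: sigma_\<omega> w)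
  then show ?thesis
    using assms \<omega>_in_\<Omega>[OF w] by (simp add: G scal_inject)
qed

text \<open>Applied to \<open>\<sigma>\<^sub>1 \<omega>\<^sub>a\<^sub>b\<^sub>c\<close>, the compatibility of metric and braiding turns into
  \<open>(g \<otimes> 1) \<sigma>\<^sub>2 \<sigma>\<^sub>1 = 1 \<otimes> g\<close>, which needs no inverse.\<close>

lemma braid_compatibility:
  assumes "\<forall>\<Phi>\<in>\<Omega> q 3. metric_id q g (\<sigma>2 q \<Phi>) = id_metric q g (inv_into (\<Omega> q 3) (\<sigma>1 q) \<Phi>)"
  shows "(\<Sum>x\<in>UNIV. \<Sum>y\<in>UNIV. \<Sum>z\<in>UNIV. braid q [a, b] [x, y] * braid q [y, c] [z, f] * G x z)
    = of_bool (a = f) * G b c"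
proof -
  let ?I = "[a, b, c]"
  have w: "?I \<in> words 3" by (simp add: mem_words)
  have s1: "\<sigma>1 q (\<omega> q ?I) = const_form q (braid1 q ?I)"
    by (simp add: \<omega>_const_form sigma1_const_form q sum.delta of_bool_def w if_distrib[of "\<lambda>x. x * _"] cong: if_cong)
  have "const_form q (braid1 q ?I) \<in> \<Omega> q 3"
    by (rule const_form_in_\<Omega>) (simp add: braid1_outside w)
  \<comment> \<open>The element is the image of a basis form under \<open>\<sigma>1\<close>, so
    injectivity makes \<open>inv_into\<close> return exactly that form.\<close>
  then have "metric_id q g (\<sigma>2 q (\<sigma>1 q (\<omega> q ?I))) = id_metric q g (\<omega> q ?I)"
    using assms inv_into_f_f[OF sigma1_inj_on[OF q(1)] \<omega>_in_\<Omega>[OF w]] by (simp add: s1)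
  then have e1: "(\<Sum>L\<in>words 3. (\<Sum>K\<in>words 3. braid1 q ?I K * braid2 q K L) * (G (L ! 0) (L ! 1) * of_bool ([f] = drop 2 L)))
      = (\<Sum>L\<in>words 3. of_bool (L = ?I) * (of_bool ([f] = take 1 L) * G (L ! 1) (L ! 2)))"
    unfolding s1 sigma2_const_form[OF q(1)] metric_id_const_form
    unfolding \<omega>_const_form id_metric_const_form const_form_inject by (rule fun_cong)
  have e2: "(\<Sum>L\<in>words 3. of_bool (L = ?I) * (of_bool ([f] = take 1 L) * G (L ! 1) (L ! 2))) = of_bool (a = f) * G b c"
    by (simp add: sum.delta of_bool_def w if_distrib[of "\<lambda>x. x * _"] cong: if_cong)
  \<comment> \<open>The intermediate word keeps \<open>c\<close> as its last letter by
    \<open>braid1\<close> and already has \<open>x\<close> as its first by \<open>braid2\<close>;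
    only its middle letter remains free.\<close>
  have "(\<Sum>K\<in>words 3. braid1 q ?I K * braid2 q K [x, z, f]) = (\<Sum>y\<in>UNIV. braid q [a, b] [x, y] * braid q [y, c] [z, f])" for x z
  proof -
    have "(\<Sum>K\<in>words 3. braid1 q ?I K * braid2 q K [x, z, f]) =
        (\<Sum>x'\<in>UNIV. \<Sum>y\<in>UNIV. \<Sum>c'\<in>UNIV. if c' = c then
          (if x' = x then braid q [a, b] [x, y] * braid q [y, c] [z, f] else 0) else 0)"
      unfolding sum_words_3 by (intro sum.cong) (auto simp: braid1_def braid2_def)
    also have "\<dots> = (\<Sum>y\<in>UNIV. \<Sum>x'\<in>UNIV. if x' = x then braid q [a, b] [x, y] * braid q [y, c] [z, f] else 0)"
      by (subst sum.swap) (simp add: sum.delta)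
    finally show ?thesis by (simp add: sum.delta)
  qed
  then have "(\<Sum>L\<in>words 3. (\<Sum>K\<in>words 3. braid1 q ?I K * braid2 q K L) * (G (L ! 0) (L ! 1) * of_bool ([f] = drop 2 L)))
      = (\<Sum>x\<in>UNIV. \<Sum>z\<in>UNIV. (\<Sum>y\<in>UNIV. braid q [a, b] [x, y] * braid q [y, c] [z, f]) * G x z)"
    unfolding sum_words_3[of "\<lambda>L. _ L * (G (L ! 0) (L ! 1) * _ L)"]
    by (simp add: of_bool_def if_distrib[of "(*) _"] sum.delta cong: if_cong)
  also have "\<dots> = (\<Sum>x\<in>UNIV. \<Sum>y\<in>UNIV. \<Sum>z\<in>UNIV. braid q [a, b] [x, y] * braid q [y, c] [z, f] * G x z)"
    unfolding sum_distrib_right by (intro sum.cong refl sum.swap)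
  finally show ?thesis using e1 e2 by (simp only:)
qed

text \<open>\<open>\<omega>\<^sub>0 \<otimes> \<omega>\<^sub>0 a = q\<^sup>-\<^sup>2 a \<omega>\<^sub>0 \<otimes> \<omega>\<^sub>0\<close> with \<open>q\<^sup>-\<^sup>2 \<noteq> 1\<close>; the braiding puts no constraint on \<open>G\<^sub>0\<^sub>0\<close>.\<close>

lemma G_W0_W0: "G W0 W0 = 0"
proof -
  interpret ring "SU q" by (rule ring_SU)
  let ?x = "cls q gen_a" and ?y = "cls q (fconst (1 / q^2) * gen_a)" and ?\<omega> = "\<omega> q [W0, W0]"
  have \<omega>: "?\<omega> \<in> \<Omega> q 2" by (rule \<omega>_in_\<Omega>) (simp add: mem_words)
  have ss: "complex_of_real (sqrt q) * complex_of_real (sqrt q) = q"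
    using q by (simp flip: of_real_mult)
  have KK: "free_act q (KK^2) (fconst z * gen_a) = fconst (z / q) * gen_a" for z
    using ss by (simp add: power2_eq_square free_act_mult free_act_fgen lact_linear gact_generators
        fconst_mult_fconst_mult divide_inverse mult.assoc flip: inverse_mult_distrib)
  have KKKK: "act q (KK^2) (act q (KK^2) ?x) = ?y"
    using KK[of 1] KK[of "1 / q"] by (simp add: act_cls[OF q(1)] power2_eq_square)
  have act0: "act q 0 (cls q x) = scal q 0" "act q h (scal q 0) = scal q 0" for x h
    by (simp_all add: act_cls[OF q(1)] scal_def free_act_linear)
  \<comment> \<open>This row of \<open>ff\<close> is diagonal, so moving an element past the form
    creates no other basis forms. Each of the two legs contributes one factor 1/q on
    \<open>gen_a\<close>.\<close>
  have ff: "ff q W0 b = (if b = W0 then KK^2 else 0)" for b by (cases b) auto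
  have move1: "move q [W0] J (cls q x) = (if J = [W0] then act q (KK^2) (cls q x) else scal q 0)" for J x
  proof (cases J)
    case (Cons b L)
    then show ?thesis by (cases L) (simp_all add: ff act0 cls_hom)
  qed (simp add: cls_hom)
  have move: "move q [W0, W0] J ?x = (if J = [W0, W0] then ?y else scal q 0)" for J
  proof (cases J)
    case (Cons b L)
    have "act q 0 (scal q 0) = scal q 0" "act q 0 (act q (KK^2) ?x) = scal q 0"
      by (simp_all add: act0 act_cls[OF q(1)] scal_def)
    then show ?thesis using KKKK by (simp add: Cons move1 ff act0)
  qed (simp add: cls_hom)
  have "rmult q ?\<omega> ?x J = lmult q ?y ?\<omega> J" for J
  proof -
    have "rmult q ?\<omega> ?x J = (\<Oplus>\<^bsub>SU q\<^esub> I\<in>words (length J).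
        cls q (if I = [W0, W0] then if J = [W0, W0] then fconst (1 / q^2) * gen_a else 0 else 0))"
      unfolding rmult_def
    proof (intro finsum_cong')
      fix I
      have "\<zero>\<^bsub>SU q\<^esub> \<otimes>\<^bsub>SU q\<^esub> move q I J ?x = \<zero>\<^bsub>SU q\<^esub>"
        by (simp add: move_in_carrier[OF q(1)])
      then show "?\<omega> I \<otimes>\<^bsub>SU q\<^esub> move q I J ?x =
          cls q (if I = [W0, W0] then if J = [W0, W0] then fconst (1 / q^2) * gen_a else 0 else 0)"
        by (auto simp: \<omega>_def move cls_hom scal_def)
    qed auto
    also have "\<dots> = lmult q ?y ?\<omega> J"
      by (auto simp: finsum_cls sum.delta' mem_words lmult_def \<omega>_def cls_hom scal_def)
    finally show ?thesis .
  qed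
  then have "g (rmult q ?\<omega> ?x) = g (lmult q ?y ?\<omega>)" by presburger
  moreover have "g (rmult q ?\<omega> ?x) = g ?\<omega> \<otimes>\<^bsub>SU q\<^esub> ?x"
    using hom \<omega> cls_in_carrier unfolding bimodule_hom_def by blast
  moreover have "g (lmult q ?y ?\<omega>) = ?y \<otimes>\<^bsub>SU q\<^esub> g ?\<omega>"
    using hom \<omega> cls_in_carrier unfolding bimodule_hom_def by blast
  \<comment> \<open>Right and left linearity evaluate the same form as \<open>G W0 W0\<close> times
    \<open>gen_a\<close> and as q^-2 times that; the counit then reduces the equality of cosets to
    one of numbers.\<close>
  ultimately have "fconst (G W0 W0) * gen_a - fconst (1 / q^2) * (gen_a * fconst (G W0 W0)) \<in> SU_ideal q"
    by (simp add: G scal_def cls_hom cls_eq_iff mult.assoc)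
  also have "fconst (G W0 W0) * gen_a - fconst (1 / q^2) * (gen_a * fconst (G W0 W0)) =
      fconst (G W0 W0 * (1 - 1 / q^2)) * gen_a"
    by (simp add: fconst_comm[of gen_a] fconst_mult_fconst_mult mult.commute right_diff_distrib fconst_diff left_diff_distrib)
  finally have "G W0 W0 * (1 - 1 / complex_of_real q^2) = 0"
    by (simp add: fconst_mult_gen_a_in_SU_ideal)
  moreover have "q^2 \<noteq> 1" using q by (simp add: power2_eq_1_iff)
  then have "(complex_of_real q)^2 \<noteq> 1" by (metis of_real_eq_1_iff of_real_power)
  ultimately show ?thesis by auto
qed

text \<open>The metric would vanish identically by left linearity, so the nonzero form
  \<open>\<omega> q [Wm]\<close> would be orthogonal to everything.\<close>

lemma zero_imp_degenerate:
  assumes "\<And>a b. G a b = 0"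
  shows "\<not> nondegenerate q g"
proof
  interpret ring "SU q" by (rule ring_SU)
  assume nd: "nondegenerate q g"
  have w: "\<omega> q [Wm] \<in> \<Omega> q 1" by (rule \<omega>_in_\<Omega>) (simp add: mem_words)
  have "g \<Phi> = \<zero>\<^bsub>SU q\<^esub>" if "\<Phi> \<in> \<Omega> q 2" for \<Phi>
    unfolding bimodule_hom_expand[OF hom that]
  proof (rule add.finprod_one_eqI)
    fix I :: "ix list" assume "I \<in> words 2"
    then show "\<Phi> I \<otimes>\<^bsub>SU q\<^esub> g (\<omega> q I) = \<zero>\<^bsub>SU q\<^esub>"
      using that by (auto simp: words_2 G assms \<Omega>_def simp flip: cls_hom)
  qed
  then have "\<omega> q [Wm] = form_zero q"
    using nd w tens_in_\<Omega>[OF q(1) w] unfolding nondegenerate_def by blast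
  from fun_cong[OF this, of "[Wm]"] show False
    by (simp add: \<omega>_def form_zero_def cls_hom scal_inject)
qed

text \<open>The involution contributes a sign in each argument, and the two signs cancel.\<close>

lemma real_metricD:
  assumes "real_metric q g"
  shows "cnj (G a b) = G (bar b) (bar a)"
proof -
  have w: "\<omega> q [a] \<in> \<Omega> q 1" for a by (rule \<omega>_in_\<Omega>) (simp add: mem_words)
  have star: "form_star q (\<omega> q [a]) = inv_emb q (\<lambda>b. - of_bool (b = bar a))" for a
    unfolding form_star_\<omega>[OF q(1)] inv_emb_const_form const_form_inject
    by (auto simp: fun_eq_iff split: list.splits)
  have "su_star (g (tens q 1 (\<omega> q [a]) (\<omega> q [b]))) =
      g (tens q 1 (form_star q (\<omega> q [b])) (form_star q (\<omega> q [a])))"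
    using assms w unfolding real_metric_def by blast
  then have "cnj (G a b) = (\<Sum>x\<in>UNIV. \<Sum>y\<in>UNIV. - of_bool (x = bar b) * - of_bool (y = bar a) * G x y)"
    unfolding star metric_tens_\<omega> metric_inv_emb su_star_scal scal_inject .
  also have "\<dots> = G (bar b) (bar a)"
    by (simp add: of_bool_def if_distrib[of "\<lambda>x. x * _"] if_distrib[of "(*) _"] sum_negf sum.delta cong: if_cong)
  finally show ?thesis .
qed

lemma sigma_metric_coefficients:
  assumes "sigma_metric q g" "real_metric q g" "U1_coinvariant q g"
  obtains a where "a \<noteq> 0" "\<And>i j. G i j = g_matrix q 1 a i j"
proof -
  define s where "s = complex_of_real q"
  have s: "s \<noteq> 0" "s^2 \<noteq> 1"
  proof -
    have "q^2 \<noteq> 1" using q by (simp add: power2_eq_1_iff)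
    then show "s^2 \<noteq> 1" unfolding s_def by (metis of_real_eq_1_iff of_real_power)
  qed (use q in \<open>simp add: s_def\<close>)
  have U: "G a b = 0" if "U1_weight a + U1_weight b \<noteq> 0" for a b
    using assms(3) that unfolding U1_coinvariant_def metric_tens_\<omega> by (simp add: cls_hom scal_inject)
  have z: "G Wm Wm = 0" "G Wm W0 = 0" "G Wm Wz = 0" "G Wp Wp = 0" "G Wp W0 = 0" "G Wp Wz = 0"
     "G W0 Wm = 0" "G W0 Wp = 0" "G Wz Wm = 0" "G Wz Wp = 0" "G W0 W0 = 0"
    by (simp_all add: U G_W0_W0)
  have inv: "\<forall>\<Phi>\<in>\<Omega> q 2. g (\<sigma> q \<Phi>) = g \<Phi>"
    and comp: "\<forall>\<Phi>\<in>\<Omega> q 3. metric_id q g (\<sigma>2 q \<Phi>) = id_metric q g (inv_into (\<Omega> q 3) (\<sigma>1 q) \<Phi>)"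
    and nd: "nondegenerate q g"
    using assms(1) by (auto simp: sigma_metric_def)
  have sym: "G Wz W0 = G W0 Wz"
    using braid_invariance[OF inv, of W0 Wz] by (simp add: UNIV_ix braid_def)
  \<comment> \<open>In this and the next two equations the last index is \<open>W0\<close> while the
    input word begins with \<open>Wm\<close>, so the right-hand side of the compatibility is
    zero.\<close>
  have 1: "(1 - s^2) * G Wp Wm = G Wz W0"
    using braid_compatibility[OF comp, of Wm Wp W0 W0] by (simp add: UNIV_ix braid_def z s_def algebra_simps)
  have 2: "(1 + s^2) * G Wp Wm = G Wz Wz"
    using braid_compatibility[OF comp, of Wm Wp Wz W0] by (simp add: UNIV_ix braid_def z s_def algebra_simps)
  have 3: "(1 / s^2 - 1) * G Wm Wp = G W0 Wz"
    using braid_compatibility[OF comp, of Wm W0 Wp W0] q by (simp add: UNIV_ix braid_def z s_def field_simps)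
  \<comment> \<open>The factor q^2 turns the coefficient of equation \<open>3\<close> into that of
    \<open>1\<close>; by symmetry both express the same number, and 1 - q^2 is then
    cancelled.\<close>
  have "(1 - s^2) * G Wm Wp = s^2 * ((1 / s^2 - 1) * G Wm Wp)"
    using s by (simp add: field_simps)
  also have "\<dots> = (1 - s^2) * (s^2 * G Wp Wm)"
    unfolding 3 sym[symmetric] 1[symmetric] by simp
  finally have 4: "G Wm Wp = s^2 * G Wp Wm"
    using s by simp
  \<comment> \<open>Swapping the two indices and exchanging + with - brings the pair back to
    itself.\<close>
  have "cnj (G Wp Wm) = G Wp Wm"
    using real_metricD[OF assms(2), of Wp Wm] by simp
  then obtain a where a: "G Wp Wm = complex_of_real a"
    by (metis Reals_cases Reals_cnj_iff)
  \<comment> \<open>Equations \<open>1\<close> and \<open>2\<close> carry positive factors, which is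
    why the sign parameter of \<open>g_matrix\<close> is 1.\<close>
  have G: "G i j = g_matrix q 1 a i j" for i j
    by (cases i; cases j) (use 1 2 4 sym in \<open>simp_all add: z a s_def\<close>)
  have "a \<noteq> 0"
  proof
    assume "a = 0"
    then have "G i j = 0" for i j
      by (cases i; cases j) (simp_all add: G)
    then show False using zero_imp_degenerate nd by blast
  qed
  then show ?thesis using G that by blast
qed

end

theorem mainTheorem3:
  fixes q :: real
  assumes "0 < q" and "q < 1"
  shows "\<forall>g\<in>G_sigma q.
      (\<exists>b\<in>G_forms q. restricts_to q g b) \<and>
      (\<exists>a::real. a \<noteq> 0 \<and> restricts_to q g (g_tilde q 1 a) \<and>
        (\<forall>u v. g_tilde q 1 a u v = Gamma_form q (- a) (inv_star u) v))"
proof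
  fix g assume g: "g \<in> G_sigma q"
  then have "\<forall>a b. g (tens q 1 (\<omega> q [a]) (\<omega> q [b])) \<in> range (scal q)"
    by (simp add: G_sigma_def)
  then have "\<forall>a b. \<exists>z. g (tens q 1 (\<omega> q [a]) (\<omega> q [b])) = scal q z"
    by blast
  then obtain G where G: "\<And>a b. g (tens q 1 (\<omega> q [a]) (\<omega> q [b])) = scal q (G a b)"
    by metis
  interpret constant_metric q g G
  proof
    show "bimodule_hom q g" using g by (simp add: G_sigma_def sigma_metric_def)
    show "g (\<omega> q [a, b]) = scal q (G a b)" for a b
      using tens_\<omega>[OF assms(1), of "[a]" "[b]"] G[of a b] by simp
  qed (fact assms)+
  obtain a where a: "a \<noteq> 0" and coeff: "\<And>i j. G i j = g_matrix q 1 a i j"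
    using g by (auto simp: G_sigma_def intro: sigma_metric_coefficients)
  have r: "restricts_to q g (g_tilde q 1 a)"
    using metric_inv_emb by (simp add: restricts_to_def g_tilde_def coeff mult_ac)
  have "g_tilde q 1 a \<in> G_forms q"
    using a by (auto simp: G_forms_def)
  \<comment> \<open>The minus sign of the involution accounts for \<open>- a\<close>, and its
    exchange of + and - moves the off-diagonal entries of the metric to the diagonal entries of the
    contraction.\<close>
  moreover have "g_tilde q 1 a u v = Gamma_form q (- a) (inv_star u) v" for u v
    by (simp add: g_tilde_def Gamma_form_def inv_star_def UNIV_ix algebra_simps)
  ultimately show "(\<exists>b\<in>G_forms q. restricts_to q g b) \<and>
      (\<exists>a::real. a \<noteq> 0 \<and> restricts_to q g (g_tilde q 1 a) \<and>
        (\<forall>u v. g_tilde q 1 a u v = Gamma_form q (- a) (inv_star u) v))"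
    using r a by blast
qed

end
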